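(* Let $\mathfrak H$, $\mathcal H$ be Hilbert spaces. Let $T$ be a closed symmetric linear relation in $\mathfrak H$, let $\Pi_\Gamma=(\mathcal H,\Gamma_0,\Gamma_1)$ be an ordinary boundary triple for $T^*$ with Weyl function $M_\Gamma$. Let $E$ and $G$ be densely defined operators in $\mathcal H$ with $E\subseteq E^*$ and $G$ injective with dense range, let $G_E:=G|_{\operatorname{dom}E}$, $E_G:=E|_{\operatorname{dom}G}$, let $$V:=\begin{pmatrix}G^{-1}&0\\ EG^{-1}&G^*\end{pmatrix},\qquad \operatorname{dom}V=\operatorname{ran}G_E\times\operatorname{dom}G^*,$$ put $\Gamma':=V\Gamma$, and suppose in addition that $$\operatorname{mul}\overline G\subseteq\overline{\operatorname{ran}}\,G_E .$$ Then $\Pi_{\Gamma'}=(\mathcal H,\Gamma_0',\Gamma_1')$, where $$\Gamma'_0:=G_E^{-1}\Gamma_0,\quad \Gamma_1':=E_GG_E^{-1}\Gamma_0+G^*\Gamma_1\quad\text{on}\quad A'_*=\{\widehat f\in T^*:\Gamma_0\widehat f\in\operatorname{ran}G_E,\ \Gamma_1\widehat f\in\operatorname{dom}G^*\},$$ is an isometric boundary triple for the adjoint $$T'^{*}=\{\widehat f\in T^*:\Gamma_0\widehat f\in\overline{\operatorname{ran}}\,G_E,\ \Gamma_1\widehat f\in\overline{\operatorname{dom}}\,G^*\}$$ of a closed symmetric extension $$T'=\{\widehat f\in T^*:\Gamma_0\widehat f\in\operatorname{mul}\overline G,\ \Gamma_1\widehat f\in\ker G_E^*\}$$ of $T$. The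 Weyl function $M_{\Gamma'}$ corresponding to $\Pi_{\Gamma'}$ is given by $$M_{\Gamma'}(z)=E_G+G^*M^0_\Gamma(z)G_E,\qquad M_\Gamma^0(z):=M_\Gamma(z)|_{\operatorname{ran}G_E},$$ $$\operatorname{dom}M_{\Gamma'}(z)=\{h\in\operatorname{dom}E_G:M^0_\Gamma(z)G_Eh\in\operatorname{dom}G^*\}\subseteq\operatorname{ran}\Gamma_0'$$ $$\phantom{\operatorname{dom}M_{\Gamma'}(z)}\subseteq\operatorname{ran}\Gamma_0'=\{h\in\operatorname{dom}E_G:(\exists\widehat f_0\in T_0)\ \Gamma_1\widehat f_0+M^0_\Gamma(z)G_Eh\in\operatorname{dom}G^*\}$$ for $z\in\mathbb C_*$, where $T_0:=\ker\Gamma_0$. If in particular $$E_G^*|_{\ker\overline G}=\{0\},\qquad\Gamma_1(T_0)\subseteq\operatorname{dom}G^*,$$ then $\overline{\operatorname{dom}}\,G^*=\overline{\operatorname{ran}}\,G_E=\mathcal H$, $\Pi_{\Gamma'}$ is a quasi boundary triple for $T^*$, and $\operatorname{dom}M_{\Gamma'}(z)=\operatorname{ran}\Gamma_0'$.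
   Context: Linear relations: a relation from a linear space $X$ to a linear space $Y$ is a linear subset $R\subseteq X\times Y$ (a relation in $X$ if $X=Y$); operators are identified with their graphs. $\ker R=\{x:(x,0)\in R\}$, $\operatorname{mul}R=\{y:(0,y)\in R\}$, $R|_S=R\cap(S\times Y)$; $\overline R$ is the closure, $\overline{\operatorname{dom}}\,R$, $\overline{\operatorname{ran}}\,R$ are the closures of domain and range; $R(S)=\{y:\exists x\in S,(x,y)\in R\}$; $QR=\{(x,w):\exists y,\ (x,y)\in R,(y,w)\in Q\}$. Adjoints $^*$ are Hilbert space adjoints in the sense of relations: for $T\subseteq\mathfrak H^2$, $T^*=\{(g,g'):\langle f',g\rangle=\langle f,g'\rangle\ \forall(f,f')\in T\}$; $T$ is symmetric if $T\subseteq T^*$, self-adjoint if $T=T^*$. $G$ is not assumed closable and $G_E$, $E_G$ are not assumed densely defined; $\operatorname{dom}G_E=\operatorname{dom}E_G=\operatorname{dom}E\cap\operatorname{dom}G$. $E_G^*$, $G_E^*$ are the adjoints of $E_G$, $G_E$; $E_G^*|_{\ker\overline G}=\{0\}$ means that this restricted relation is $\{(0,0)\}$. $V$ is an injective operator in $\mathcal H^2$, $V(l,l')=(G^{-1}l,EG^{-1}l+G^*l')$, isometric with respect to $\widehat J^\circ_{\mathcal H}$ below. $\mathbb C_*=\mathbb C\setminus\mathbb R$. Boundary triples (Hilbert space case): put $\widehat J^\circ_{\mathfrak H}=\begin{pmatrix}0&-iI\\ iI&0\end{pmatrix}$ on $\mathfrak H^2$ and likewise $\widehat J^\circ_{\mathcal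 H}$ on $\mathcal H^2$. For $\Gamma\subseteq\mathfrak H^2\times\mathcal H^2$ let $\Gamma^+=\widehat J^\circ_{\mathfrak H}\Gamma^*\widehat J^\circ_{\mathcal H}$ and $\Gamma_\#=(\Gamma^+)^{-1}$. For a closed symmetric relation $T$ in $\mathfrak H$, an isometric boundary triple $(\mathcal H,\Gamma_0,\Gamma_1)$ for $T^*$ is an operator $\Gamma:\widehat f\mapsto(\Gamma_0\widehat f,\Gamma_1\widehat f)$ from $\operatorname{dom}\Gamma\subseteq\mathfrak H^2$ to $\mathcal H^2$ with $\Gamma\subseteq\Gamma_\#$ and $T=\ker\Gamma_\#$. It is an ordinary boundary triple for $T^*$ if in addition $\Gamma=\Gamma_\#$ and $\Gamma$ is surjective (then $\operatorname{dom}\Gamma=T^*$). It is a quasi boundary triple for $T^*$ if it is an isometric boundary triple for $T^*$ such that $\operatorname{ran}\Gamma$ is dense in $\mathcal H^2$ and $\ker\Gamma_0$ is self-adjoint. The Weyl family (Weyl function, if its values are operators) is $M_\Gamma(z)=\{(\Gamma_0\widehat f,\Gamma_1\widehat f):\widehat f=(f,zf)\in\operatorname{dom}\Gamma\}$, $z\in\mathbb C_*$. *)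

theory Defs
  imports "HOL-Analysis.Analysis"
begin

section \<open>Complex Hilbert spaces\<close>

text \<open>
  The real inner product, norm and topology of a complex Hilbert space are those inherited from
  the class \<open>real_inner\<close>: \<open>x \<bullet> y\<close> is the real part of the complex inner product, so positive definiteness and
  \<open>norm x = sqrt (Re (cinner x x))\<close> come from there. The complex inner product is linear in the
  first argument; adjoints do not depend on this choice.
\<close>

class chilbert = real_inner + complete_space +
  fixes cscale :: "complex \<Rightarrow> 'a \<Rightarrow> 'a"  (infixr \<open>*\<^sub>c\<close> 75)
    and cinner :: "'a \<Rightarrow> 'a \<Rightarrow> complex"
  assumes cscale_add_right: "a *\<^sub>c (x + y) = a *\<^sub>c x + a *\<^sub>c y"
    and cscale_add_left: "(a + b) *\<^sub>c x = a *\<^sub>c x + b *\<^sub>c x"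
    and cscale_cscale: "a *\<^sub>c (b *\<^sub>c x) = (a * b) *\<^sub>c x"
    and scaleR_cscale: "scaleR r x = complex_of_real r *\<^sub>c x"
    and cinner_commute: "cinner x y = cnj (cinner y x)"
    and cinner_add_left: "cinner (x + y) z = cinner x z + cinner y z"
    and cinner_cscale_left: "cinner (a *\<^sub>c x) y = a * cinner x y"
    and inner_eq_Re_cinner: "inner x y = Re (cinner x y)"

global_interpretation cvec: vector_space "cscale :: complex \<Rightarrow> 'a \<Rightarrow> 'a::chilbert"
proof
  show "1 *\<^sub>c x = x" for x :: 'a
    using scaleR_cscale[of 1 x] by simp
qed (simp_all add: cscale_add_right cscale_add_left cscale_cscale)

instantiation complex :: chilbert
begin
definition cscale_complex :: "complex \<Rightarrow> complex \<Rightarrow> complex" where "cscale_complex a x = a * x"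
definition cinner_complex :: "complex \<Rightarrow> complex \<Rightarrow> complex" where "cinner_complex x y = x * cnj y"
instance
  by standard
    (simp_all add: cscale_complex_def cinner_complex_def algebra_simps scaleR_conv_of_real
      inner_complex_def)
end

instantiation prod :: (chilbert, chilbert) chilbert
begin
definition cscale_prod :: "complex \<Rightarrow> 'a \<times> 'b \<Rightarrow> 'a \<times> 'b" where
  "cscale_prod a x = (a *\<^sub>c fst x, a *\<^sub>c snd x)"
definition cinner_prod :: "'a \<times> 'b \<Rightarrow> 'a \<times> 'b \<Rightarrow> complex" where
  "cinner_prod x y = cinner (fst x) (fst y) + cinner (snd x) (snd y)"
instance
proof
  fix x y :: "'a \<times> 'b"
  show "cinner x y = cnj (cinner y x)"
    unfolding cinner_prod_def complex_cnj_add by (metis cinner_commute)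
qed (simp_all add: cscale_prod_def cinner_prod_def prod_eq_iff algebra_simps cscale_add_right
      cscale_add_left cscale_cscale scaleR_cscale cinner_add_left cinner_cscale_left
      inner_eq_Re_cinner inner_prod_def)
end

section \<open>Linear relations\<close>

text \<open>
  Relations are sets of pairs. Domain, range, image and inverse are \<open>Domain\<close>, \<open>Range\<close>, \<open>``\<close> and
  \<open>converse\<close>. The product \<open>QR\<close> (first \<open>R\<close>, then \<open>Q\<close>) is \<open>R O Q\<close>, with the factors in the
  opposite order. The closure of a relation is its topological \<open>closure\<close> in the product space.
\<close>

definition linear_relation :: "('a::chilbert \<times> 'b::chilbert) set \<Rightarrow> bool" where
  "linear_relation R \<longleftrightarrow> cvec.subspace R"

definition rker :: "('a \<times> 'b::zero) set \<Rightarrow> 'a set" where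
  "rker R = {x. (x, 0) \<in> R}"

definition rmul :: "('a::zero \<times> 'b) set \<Rightarrow> 'b set" where
  "rmul R = {y. (0, y) \<in> R}"

definition rrestrict :: "('a \<times> 'b) set \<Rightarrow> 'a set \<Rightarrow> ('a \<times> 'b) set" where
  "rrestrict R S = R \<inter> (S \<times> UNIV)"

definition rsum :: "('a \<times> 'b::plus) set \<Rightarrow> ('a \<times> 'b) set \<Rightarrow> ('a \<times> 'b) set" where
  "rsum R S = {(x, y + z) |x y z. (x, y) \<in> R \<and> (x, z) \<in> S}"

definition radj :: "('a::chilbert \<times> 'b::chilbert) set \<Rightarrow> ('b \<times> 'a) set" where
  "radj R = {(g, g'). \<forall>(f, f') \<in> R. cinner f' g = cinner f g'}"

definition is_operator :: "('a::chilbert \<times> 'b::chilbert) set \<Rightarrow> bool" where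
  "is_operator R \<longleftrightarrow> linear_relation R \<and> rmul R = {0}"

definition densely_defined :: "('a::chilbert \<times> 'b) set \<Rightarrow> bool" where
  "densely_defined R \<longleftrightarrow> closure (Domain R) = UNIV"

definition symmetric_rel :: "('a::chilbert \<times> 'a) set \<Rightarrow> bool" where
  "symmetric_rel T \<longleftrightarrow> T \<subseteq> radj T"

definition selfadjoint_rel :: "('a::chilbert \<times> 'a) set \<Rightarrow> bool" where
  "selfadjoint_rel T \<longleftrightarrow> T = radj T"

definition closed_symmetric :: "('a::chilbert \<times> 'a) set \<Rightarrow> bool" where
  "closed_symmetric T \<longleftrightarrow> linear_relation T \<and> closed T \<and> symmetric_rel T"

section \<open>Boundary triples\<close>

definition Jop :: "(('a::chilbert \<times> 'a) \<times> ('a \<times> 'a)) set" where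
  "Jop = {((f, f'), (- (\<i> *\<^sub>c f'), \<i> *\<^sub>c f)) |f f'. True}"

definition rplus :: "(('a::chilbert \<times> 'a) \<times> ('b::chilbert \<times> 'b)) set
    \<Rightarrow> (('b \<times> 'b) \<times> ('a \<times> 'a)) set" where
  "rplus \<Gamma> = Jop O radj \<Gamma> O Jop"

definition rsharp :: "(('a::chilbert \<times> 'a) \<times> ('b::chilbert \<times> 'b)) set
    \<Rightarrow> (('a \<times> 'a) \<times> ('b \<times> 'b)) set" where
  "rsharp \<Gamma> = (rplus \<Gamma>)\<inverse>"

definition bfst :: "('c \<times> ('b \<times> 'b)) set \<Rightarrow> ('c \<times> 'b) set" where
  "bfst \<Gamma> = {(f, l). \<exists>l'. (f, (l, l')) \<in> \<Gamma>}"

definition bsnd :: "('c \<times> ('b \<times> 'b)) set \<Rightarrow> ('c \<times> 'b) set" where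
  "bsnd \<Gamma> = {(f, l'). \<exists>l. (f, (l, l')) \<in> \<Gamma>}"

definition bpair :: "('c \<times> 'b) set \<Rightarrow> ('c \<times> 'b) set \<Rightarrow> ('c \<times> ('b \<times> 'b)) set" where
  "bpair \<Gamma>\<^sub>0 \<Gamma>\<^sub>1 = {(f, (l, l')). (f, l) \<in> \<Gamma>\<^sub>0 \<and> (f, l') \<in> \<Gamma>\<^sub>1}"

text \<open>\<open>isometric_bt T \<Gamma>\<close>: the operator \<open>\<Gamma>\<close> is an isometric boundary triple for the adjoint of \<open>T\<close>
  (not for \<open>T\<close> itself); likewise for the other two kinds of triples.\<close>

definition isometric_bt ::
    "('a::chilbert \<times> 'a) set \<Rightarrow> (('a \<times> 'a) \<times> ('b::chilbert \<times> 'b)) set \<Rightarrow> bool" where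
  "isometric_bt T \<Gamma> \<longleftrightarrow>
     closed_symmetric T \<and> is_operator \<Gamma> \<and> \<Gamma> \<subseteq> rsharp \<Gamma> \<and> T = rker (rsharp \<Gamma>)"

definition ordinary_bt ::
    "('a::chilbert \<times> 'a) set \<Rightarrow> (('a \<times> 'a) \<times> ('b::chilbert \<times> 'b)) set \<Rightarrow> bool" where
  "ordinary_bt T \<Gamma> \<longleftrightarrow> isometric_bt T \<Gamma> \<and> \<Gamma> = rsharp \<Gamma> \<and> Range \<Gamma> = UNIV"

definition quasi_bt ::
    "('a::chilbert \<times> 'a) set \<Rightarrow> (('a \<times> 'a) \<times> ('b::chilbert \<times> 'b)) set \<Rightarrow> bool" where
  "quasi_bt T \<Gamma> \<longleftrightarrow>
     isometric_bt T \<Gamma> \<and> closure (Range \<Gamma>) = UNIV \<and> selfadjoint_rel (rker (bfst \<Gamma>))"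

definition weyl_family ::
    "(('a::chilbert \<times> 'a) \<times> ('b \<times> 'b)) set \<Rightarrow> complex \<Rightarrow> ('b \<times> 'b) set" where
  "weyl_family \<Gamma> z = {p. \<exists>f. ((f, z *\<^sub>c f), p) \<in> \<Gamma>}"

text \<open>The operator given by the block matrix with rows \<open>(G\<^sup>-\<^sup>1, 0)\<close> and \<open>(E G\<^sup>-\<^sup>1, G\<^sup>*)\<close>, on the
  domain on which all entries are defined (computed in \<open>Domain_Vop\<close>).\<close>

definition Vop :: "('b::chilbert \<times> 'b) set \<Rightarrow> ('b \<times> 'b) set \<Rightarrow> (('b \<times> 'b) \<times> ('b \<times> 'b)) set" where
  "Vop E G = {((l, l'), (h, k + m)) |l l' h k m.
     (l, h) \<in> G\<inverse> \<and> (l, k) \<in> G\<inverse> O E \<and> (l', m) \<in> radj G}"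

lemma Domain_Vop: "Domain (Vop E G) = Range (rrestrict G (Domain E)) \<times> Domain (radj G)"
  by (force simp: Vop_def rrestrict_def Domain_iff Range_iff relcomp_unfold)

end

theory Submission
  imports Defs
begin

text \<open>
  Write \<open>\<omega>(p, q) = \<langle>p\<^sub>2, q\<^sub>1\<rangle> - \<langle>p\<^sub>1, q\<^sub>2\<rangle>\<close>, so that \<open>R\<^sup>*\<close> is the \<open>\<omega>\<close>-complement of \<open>R\<close> and
  \<open>\<Gamma>\<^sub>#\<close> consists of the pairs satisfying Green's identity \<open>\<omega>(f, u) = \<omega>(l, h)\<close> against all of
  \<open>\<Gamma>\<close>. As \<open>\<Gamma> = \<Gamma>\<^sub>#\<close> is onto, the uniform boundedness principle makes it bounded, hence its
  domain is closed and equals \<open>T\<^sup>*\<close>. Consequently \<open>(\<Gamma>\<^sup>-\<^sup>1 L)\<^sup>* = \<Gamma>\<^sup>-\<^sup>1 (L\<^sup>*)\<close> for every \<open>L\<close> containing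
  \<open>0\<close>: adjoints of extensions of \<open>T\<close> are computed in the boundary space. Since \<open>V\<close> preserves
  \<open>\<omega>\<close>, everything about \<open>T'\<close> reduces to the complements
  \<open>(ran G\<^sub>E \<times> dom G\<^sup>*)\<^sup>* = mul (closure G) \<times> ker G\<^sub>E\<^sup>*\<close>. The range of \<open>\<Gamma>\<^sub>0'\<close> is found by
  splitting off an eigenvector, which is possible because \<open>ker \<Gamma>\<^sub>0\<close> is self-adjoint. In the quasi
  case \<open>dom G\<^sup>*\<close> is everything, so \<open>(x, x')\<close> orthogonal to \<open>ran V\<close> gives \<open>(x', - x)\<close> in
  \<open>E\<^sub>G\<^sup>*\<close> restricted to \<open>ker (closure G)\<close>, which is trivial.
\<close>

section \<open>Complex Hilbert spaces\<close>

lemma cinner_add_right: "cinner x (y + z) = cinner x y + cinner x (z::'a::chilbert)"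
  by (metis cinner_add_left cinner_commute complex_cnj_add)

lemma cinner_cscale_right: "cinner x (a *\<^sub>c y) = cnj a * cinner x (y::'a::chilbert)"
  by (metis cinner_cscale_left cinner_commute complex_cnj_mult)

lemma cinner_zero_left [simp]: "cinner 0 (y::'a::chilbert) = 0"
  using cinner_add_left[of 0 0 y] by simp

lemma cinner_zero_right [simp]: "cinner (y::'a::chilbert) 0 = 0"
  using cinner_add_right[of y 0 0] by simp

lemma cinner_minus_left [simp]: "cinner (- x) (y::'a::chilbert) = - cinner x y"
  using cinner_add_left[of x "- x" y] by (simp add: eq_neg_iff_add_eq_0 add.commute)

lemma cinner_minus_right [simp]: "cinner (x::'a::chilbert) (- y) = - cinner x y"
  using cinner_add_right[of x y "- y"] by (simp add: eq_neg_iff_add_eq_0 add.commute)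

lemma cinner_diff_left: "cinner (x - y) z = cinner x z - cinner y (z::'a::chilbert)"
  using cinner_add_left[of x "- y" z] by simp

lemma cinner_diff_right: "cinner z (x - y) = cinner z x - cinner z (y::'a::chilbert)"
  using cinner_add_right[of z x "- y"] by simp

lemmas cinner_simps = cinner_add_left cinner_add_right cinner_diff_left cinner_diff_right
  cinner_cscale_left cinner_cscale_right

lemma cinner_self: "cinner x x = complex_of_real ((norm (x::'a::chilbert))\<^sup>2)"
proof (rule complex_eqI)
  show "Re (cinner x x) = Re (complex_of_real ((norm x)\<^sup>2))"
    by (simp add: inner_eq_Re_cinner[symmetric] power2_norm_eq_inner)
  have "Im (cinner x x) = - Im (cinner x x)"
    by (subst (1) cinner_commute) simp
  then show "Im (cinner x x) = Im (complex_of_real ((norm x)\<^sup>2))"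
    by simp
qed

lemma cinner_self_eq_0 [simp]: "cinner x x = 0 \<longleftrightarrow> (x::'a::chilbert) = 0"
  by (simp add: cinner_self)

lemma cinner_eq_0_commute: "cinner x y = 0 \<longleftrightarrow> cinner y (x::'a::chilbert) = 0"
  by (metis cinner_commute complex_cnj_zero_iff)

lemma norm_cscale: "norm (a *\<^sub>c x) = norm a * norm (x::'a::chilbert)"
proof -
  have "complex_of_real ((norm (a *\<^sub>c x))\<^sup>2) = a * cnj a * complex_of_real ((norm x)\<^sup>2)"
    unfolding cinner_self[symmetric] by (simp add: cinner_simps)
  also have "\<dots> = complex_of_real ((norm a * norm x)\<^sup>2)"
    by (simp add: complex_norm_square[symmetric] power_mult_distrib)
  finally have "(norm (a *\<^sub>c x))\<^sup>2 = (norm a * norm x)\<^sup>2"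
    by (simp only: of_real_eq_iff)
  then show ?thesis
    by (simp add: power2_eq_iff_nonneg)
qed

text \<open>Multiplying \<open>x\<close> by the unimodular scalar \<open>a\<close> makes the inner
  product real and non-negative, so the real Cauchy-Schwarz inequality applies.\<close>

lemma norm_cinner_le: "norm (cinner x y) \<le> norm x * norm (y::'a::chilbert)"
proof (cases "cinner x y = 0")
  case False
  define a where "a = cnj (cinner x y) / norm (cinner x y)"
  have a: "norm a = 1"
    using False by (simp add: a_def norm_divide)
  have "a * cinner x y = norm (cinner x y)"
    using False by (simp add: a_def field_simps complex_norm_square[symmetric] power2_eq_square)
  then have "norm (cinner x y) = inner (a *\<^sub>c x) y"
    by (simp add: inner_eq_Re_cinner cinner_simps)
  also have "\<dots> \<le> norm (a *\<^sub>c x) * norm y"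
    by (rule norm_cauchy_schwarz)
  finally show ?thesis
    by (simp add: norm_cscale a)
qed simp

lemma bounded_bilinear_cinner: "bounded_bilinear (cinner :: 'a::chilbert \<Rightarrow> 'a \<Rightarrow> complex)"
proof
  show "\<exists>K. \<forall>a b. norm (cinner a (b::'a)) \<le> norm a * norm b * K"
    using norm_cinner_le by (metis mult.right_neutral)
qed (simp_all add: cinner_simps scaleR_cscale scaleR_conv_of_real cscale_complex_def)

lemma bounded_linear_cscale: "bounded_linear ((*\<^sub>c) a :: 'a::chilbert \<Rightarrow> 'a)"
  by (rule bounded_linear_intro[where K = "norm a"])
    (simp_all add: cscale_add_right scaleR_cscale cscale_cscale norm_cscale mult.commute)

lemmas continuous_on_cinner [continuous_intros] =
  bounded_bilinear.continuous_on[OF bounded_bilinear_cinner]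
lemmas tendsto_cscale = bounded_linear.tendsto[OF bounded_linear_cscale]

text \<open>Serves to lift convergence through an a priori estimate, both for the range of a
  self-adjoint relation minus \<open>z\<close> and for the domain of \<Gamma>.\<close>

lemma Cauchy_dominated:
  fixes s :: "nat \<Rightarrow> 'a::real_normed_vector" and u :: "nat \<Rightarrow> 'b::real_normed_vector"
  assumes "Cauchy s" and le: "\<And>m n. norm (u m - u n) \<le> c * norm (s m - s n)"
  shows "Cauchy u"
proof (rule CauchyI)
  fix e :: real assume "0 < e"
  \<comment> \<open>The added 1 keeps \<open>d\<close> positive whatever the sign of
    \<open>c\<close>, so that \<open>e / d\<close> is a legitimate tolerance.\<close>
  define d where "d = \<bar>c\<bar> + 1"
  have "0 < d"
    by (simp add: d_def add_nonneg_pos)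
  then obtain N where N: "\<And>m n. m \<ge> N \<Longrightarrow> n \<ge> N \<Longrightarrow> norm (s m - s n) < e / d"
    using CauchyD[OF assms(1), of "e / d"] \<open>0 < e\<close> by auto
  have "norm (u m - u n) < e" if "m \<ge> N" "n \<ge> N" for m n
  proof -
    have "norm (u m - u n) \<le> d * norm (s m - s n)"
      by (rule order_trans[OF le]) (simp add: d_def mult_right_mono)
    also have "\<dots> < e"
      using N[OF that] \<open>0 < d\<close> by (simp add: field_simps)
    finally show ?thesis .
  qed
  then show "\<exists>M. \<forall>m\<ge>M. \<forall>n\<ge>M. norm (u m - u n) < e"
    by blast
qed

lemma csubspace_closure:
  fixes S :: "'a::chilbert set"
  assumes "cvec.subspace S"
  shows "cvec.subspace (closure S)"
proof (rule cvec.subspaceI)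
  show "0 \<in> closure S"
    using assms closure_subset cvec.subspace_0 by blast
  show "x + y \<in> closure S" if x: "x \<in> closure S" and y: "y \<in> closure S" for x y
  proof -
    from x y obtain u v where "\<And>n. u n \<in> S" "u \<longlonglongrightarrow> x" "\<And>n. v n \<in> S" "v \<longlonglongrightarrow> y"
      unfolding closure_sequential by blast
    then have "\<forall>n. u n + v n \<in> S" "(\<lambda>n. u n + v n) \<longlonglongrightarrow> x + y"
      using assms by (auto intro: cvec.subspace_add tendsto_add)
    then show ?thesis
      unfolding closure_sequential by (intro exI[of _ "\<lambda>n. u n + v n"] conjI)
  qed
  show "a *\<^sub>c x \<in> closure S" if x: "x \<in> closure S" for a x
  proof -
    from x obtain u where "\<And>n. u n \<in> S" "u \<longlonglongrightarrow> x"
      unfolding closure_sequential by blast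
    then have "\<forall>n. a *\<^sub>c u n \<in> S" "(\<lambda>n. a *\<^sub>c u n) \<longlonglongrightarrow> a *\<^sub>c x"
      using assms by (auto intro: cvec.subspace_scale tendsto_cscale)
    then show ?thesis
      unfolding closure_sequential by (intro exI[of _ "\<lambda>n. a *\<^sub>c u n"] conjI)
  qed
qed

section \<open>Closest points, orthogonal projection and double complements\<close>

lemma csubspace_imp_subspace:
  fixes S :: "'a::chilbert set"
  assumes "cvec.subspace S"
  shows "subspace S"
  using assms by (auto simp: subspace_def cvec.subspace_def scaleR_cscale)

text \<open>A minimizing sequence is Cauchy by the parallelogram law, because midpoints stay in the
  convex set \<open>S\<close>; completeness then supplies the minimizer.\<close>

lemma closest_point_exists:
  fixes S :: "'a::{real_inner,complete_space} set"
  assumes "convex S" "closed S" "S \<noteq> {}"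
  shows "\<exists>p\<in>S. \<forall>s\<in>S. dist x p \<le> dist x s"
proof -
  define d where "d = infdist x S"
  have d: "0 \<le> d" "\<And>s. s \<in> S \<Longrightarrow> d \<le> dist x s"
    by (simp_all add: d_def infdist_nonneg infdist_le)
  have "\<exists>s\<in>S. dist x s < d + 1 / Suc n" for n
  proof (rule ccontr)
    assume *: "\<not> (\<exists>s\<in>S. dist x s < d + 1 / Suc n)"
    have "d + 1 / Suc n \<le> infdist x S"
      unfolding infdist_notempty[OF assms(3)]
      by (rule cINF_greatest) (use assms(3) * in \<open>auto simp: not_less\<close>)
    then show False
      by (simp add: d_def divide_le_0_iff)
  qed
  then obtain s where s: "\<And>n. s n \<in> S" "\<And>n. dist x (s n) < d + 1 / Suc n"
    by metis
  \<comment> \<open>Parallelogram identity at \<open>x\<close>, combined with the fact that the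
    midpoint of \<open>u\<close> and \<open>v\<close> has distance at least \<open>d\<close> from
    \<open>x\<close>.\<close>
  have par: "(dist u v)\<^sup>2 \<le> 2 * ((dist x u)\<^sup>2 - d\<^sup>2) + 2 * ((dist x v)\<^sup>2 - d\<^sup>2)"
    if "u \<in> S" "v \<in> S" for u v
  proof -
    have "(1/2) *\<^sub>R u + (1/2) *\<^sub>R v \<in> S"
      using assms(1) that by (rule convexD) auto
    then have "d \<le> dist x ((1/2) *\<^sub>R u + (1/2) *\<^sub>R v)"
      by (rule d(2))
    then have "d\<^sup>2 \<le> (norm (x - ((1/2) *\<^sub>R u + (1/2) *\<^sub>R v)))\<^sup>2"
      using d(1) by (simp add: dist_norm power_mono)
    then show ?thesis
      unfolding dist_norm power2_norm_eq_inner
      by (simp add: inner_simps inner_commute algebra_simps)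
  qed
  have lim: "(\<lambda>n. (d + 1 / Suc n)\<^sup>2 - d\<^sup>2) \<longlonglongrightarrow> (d + 0)\<^sup>2 - d\<^sup>2"
    using LIMSEQ_inverse_real_of_nat by (intro tendsto_intros) (simp add: inverse_eq_divide)
  have "Cauchy s"
  proof (rule metric_CauchyI)
    fix e :: real assume "0 < e"
    \<comment> \<open>The quarter compensates for the two factors 2 in \<open>par\<close>: the two
      terms together stay below \<open>e\<^sup>2\<close>.\<close>
    then have "\<forall>\<^sub>F n in sequentially. (d + 1 / Suc n)\<^sup>2 - d\<^sup>2 < e\<^sup>2 / 4"
      by (intro order_tendstoD(2)[OF lim]) simp
    then obtain N where N: "\<And>n. n \<ge> N \<Longrightarrow> (d + 1 / Suc n)\<^sup>2 - d\<^sup>2 < e\<^sup>2 / 4"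
      unfolding eventually_sequentially by blast
    have *: "(dist x (s n))\<^sup>2 - d\<^sup>2 < e\<^sup>2 / 4" if "n \<ge> N" for n
      using N[OF that] power_strict_mono[OF s(2)[of n], of 2] by simp
    have "dist (s m) (s n) < e" if "m \<ge> N" "n \<ge> N" for m n
    proof -
      have "(dist (s m) (s n))\<^sup>2 < e\<^sup>2"
        using par[OF s(1)[of m] s(1)[of n]] *[OF that(1)] *[OF that(2)] by argo
      then show ?thesis
        using \<open>0 < e\<close> power2_less_imp_less by fastforce
    qed
    then show "\<exists>M. \<forall>m\<ge>M. \<forall>n\<ge>M. dist (s m) (s n) < e"
      by blast
  qed
  then obtain p where p: "s \<longlonglongrightarrow> p"
    using Cauchy_convergent_iff convergent_def by blast
  then have "p \<in> S"
    using assms(2) s(1) closed_sequentially by blast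
  moreover have "dist x p \<le> d + 0"
  proof (rule LIMSEQ_le)
    show "(\<lambda>n. dist x (s n)) \<longlonglongrightarrow> dist x p"
      by (intro tendsto_intros p)
    show "(\<lambda>n. d + 1 / Suc n) \<longlonglongrightarrow> d + 0"
      using LIMSEQ_inverse_real_of_nat by (intro tendsto_intros) (simp add: inverse_eq_divide)
    show "\<exists>N. \<forall>n\<ge>N. dist x (s n) \<le> d + 1 / Suc n"
      using s(2) less_imp_le by blast
  qed
  ultimately show ?thesis
    using d(2) by (intro bexI[of _ p]) (auto intro: order_trans)
qed

definition orth :: "'a::chilbert set \<Rightarrow> 'a set" where
  "orth S = {y. \<forall>x\<in>S. cinner x y = 0}"

lemma csubspace_orth: "cvec.subspace (orth S)"
  by (rule cvec.subspaceI) (auto simp: orth_def cinner_simps)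

lemma zero_mem_orth [simp]: "0 \<in> orth S"
  by (simp add: orth_def)

lemma closed_orth: "closed (orth S)"
proof -
  have "orth S = (\<Inter>x\<in>S. {y. cinner x y = 0})"
    by (auto simp: orth_def)
  also have "closed \<dots>"
    by (intro closed_INT ballI closed_Collect_eq continuous_intros)
  finally show ?thesis .
qed

lemma orth_anti_mono: "S \<subseteq> S' \<Longrightarrow> orth S' \<subseteq> orth S"
  by (auto simp: orth_def)

lemma orth_UNIV: "orth UNIV = {0}"
  by (auto simp: orth_def) (metis cinner_self_eq_0)

lemma orth_zero: "orth {0} = UNIV"
  by (auto simp: orth_def)

text \<open>The closest point \<open>p\<close> satisfies a variational inequality. Applied to
  \<open>s\<close> and \<open>- s\<close> it makes the real inner product vanish on the
  subspace.\<close>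

lemma orth_projection:
  fixes S :: "'a::chilbert set"
  assumes "cvec.subspace S" "closed S"
  shows "\<exists>p\<in>S. x - p \<in> orth S"
proof -
  have "subspace S"
    using assms(1) by (rule csubspace_imp_subspace)
  then have "convex S" "S \<noteq> {}"
    using subspace_imp_convex subspace_0 by auto
  then obtain p where p: "p \<in> S" "\<forall>s\<in>S. dist x p \<le> dist x s"
    using closest_point_exists assms(2) by metis
  have le: "inner (x - p) s \<le> 0" if "s \<in> S" for s
    using any_closest_point_dot[OF \<open>convex S\<close> assms(2) p(1) _ p(2), of "p + s"] p(1) that assms(1)
    by (simp add: cvec.subspace_add)
  have eq: "inner (x - p) s = 0" if "s \<in> S" for s
    using le[OF that] le[of "- s"] that assms(1) by (simp add: cvec.subspace_neg)
  have "cinner s (x - p) = 0" if "s \<in> S" for s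
  proof -
    have "Re (cinner s (x - p)) = 0"
      using eq[OF that] by (simp add: inner_commute inner_eq_Re_cinner[symmetric])
    \<comment> \<open>Testing with \<open>\<i> *\<^sub>c s\<close> instead of \<open>s\<close> turns
      the imaginary part of the inner product into a real part, up to sign.\<close>
    moreover have "Re (cinner (\<i> *\<^sub>c s) (x - p)) = 0"
      using eq[of "\<i> *\<^sub>c s"] that assms(1)
      by (simp add: inner_commute inner_eq_Re_cinner[symmetric] cvec.subspace_scale)
    ultimately show ?thesis
      by (simp add: cinner_cscale_left complex_eq_iff)
  qed
  with p(1) show ?thesis
    by (auto simp: orth_def)
qed

text \<open>For \<open>x\<close> in the double complement, the difference of \<open>x\<close> and
  its projection onto \<open>closure S\<close> lies both in \<open>orth S\<close> and in
  \<open>orth (orth S)\<close>, hence is orthogonal to itself.\<close>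

lemma orth_orth:
  fixes S :: "'a::chilbert set"
  assumes "cvec.subspace S"
  shows "orth (orth S) = closure S"
proof
  have "S \<subseteq> orth (orth S)"
    by (auto simp: orth_def cinner_eq_0_commute)
  then show sub: "closure S \<subseteq> orth (orth S)"
    by (simp add: closed_orth closure_minimal)
  show "orth (orth S) \<subseteq> closure S"
  proof
    fix x assume x: "x \<in> orth (orth S)"
    obtain p where p: "p \<in> closure S" "x - p \<in> orth (closure S)"
      using orth_projection[OF csubspace_closure[OF assms] closed_closure] by blast
    have "x - p \<in> orth (orth S)"
      using x p(1) sub by (meson csubspace_orth cvec.subspace_diff subsetD)
    moreover have "x - p \<in> orth S"
      using p(2) orth_anti_mono[OF closure_subset] by blast
    ultimately have "cinner (x - p) (x - p) = 0"
      by (auto simp: orth_def)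
    then show "x \<in> closure S"
      using p(1) by simp
  qed
qed

lemma closure_eq_UNIV_iff_orth:
  fixes S :: "'a::chilbert set"
  assumes "cvec.subspace S"
  shows "closure S = UNIV \<longleftrightarrow> orth S = {0}"
proof
  assume "closure S = UNIV"
  then have "orth (orth S) = UNIV"
    using orth_orth[OF assms] by simp
  then show "orth S = {0}"
    using orth_orth[OF csubspace_orth[of S]] closed_orth[of S] by (simp add: orth_UNIV)
next
  assume "orth S = {0}"
  then show "closure S = UNIV"
    using orth_orth[OF assms] by (simp add: orth_zero)
qed

text \<open>Each \<open>h\<close> in \<open>B\<close> acts as the functional
  \<open>\<lambda>l. cinner l h\<close>. Baire's theorem gives a ball on which all of them are
  bounded by one \<open>n\<close>; taking differences moves this ball to the origin.\<close>

lemma uniform_boundedness: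
  fixes B :: "'a::chilbert set"
  assumes "\<And>l. \<exists>c. \<forall>h\<in>B. norm (cinner l h) \<le> c"
  shows "\<exists>c. \<forall>h\<in>B. norm h \<le> c"
proof -
  define F where "F n = {l. \<forall>h\<in>B. norm (cinner l h) \<le> real n}" for n :: nat
  have "F n = (\<Inter>h\<in>B. {l. norm (cinner l h) \<le> real n})" for n
    by (auto simp: F_def)
  then have closed: "closed (F n)" for n
    by (auto intro!: closed_INT closed_Collect_le continuous_intros)
  have "l \<in> (\<Union>n. F n)" for l
  proof -
    obtain c where c: "\<forall>h\<in>B. norm (cinner l h) \<le> c"
      using assms by blast
    obtain n :: nat where "c \<le> n"
      using real_arch_simple by blast
    with c have "l \<in> F n"
      by (auto simp: F_def)
    then show ?thesis
      by blast
  qed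
  then have "(\<Union>n. F n) = UNIV"
    by blast
  moreover have "interior (\<Union>n. F n) = {}" if "\<And>n. interior (F n) = {}"
    using Met_TC.metric_Baire_category_alt[of "range F"] closed complete_UNIV that
    by (force simp: mcomplete_iff_complete)
  ultimately have "\<exists>n. interior (F n) \<noteq> {}"
    by force
  then obtain n a e where e: "e > 0" "ball a e \<subseteq> F n"
    by (metis ex_in_conv mem_interior)
  have "norm h \<le> 4 * real n / e" if h: "h \<in> B" for h
  proof (cases "h = 0")
    case False
    \<comment> \<open>The multiple of \<open>h\<close> of norm \<open>e / 2\<close>: thus
      \<open>a + k\<close> stays in the ball, and pairing \<open>k\<close> with \<open>h\<close>
      recovers \<open>e / 2 * norm h\<close>.\<close>
    define k where "k = complex_of_real (e / 2 / norm h) *\<^sub>c h"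
    have k: "norm k = e / 2"
      using False e(1) by (simp add: k_def norm_cscale norm_divide)
    have "cinner k h = complex_of_real (e / 2 * norm h)"
      using False by (simp add: k_def cinner_simps cinner_self power2_eq_square)
    then have "norm (cinner k h) = e / 2 * norm h"
      using e(1) by (simp only: norm_of_real) simp
    then have "e / 2 * norm h = norm (cinner (a + k) h - cinner a h)"
      by (simp add: cinner_simps)
    also have "\<dots> \<le> norm (cinner (a + k) h) + norm (cinner a h)"
      by (rule norm_triangle_ineq4)
    also have "\<dots> \<le> real n + real n"
    proof (rule add_mono)
      have "a + k \<in> F n" "a \<in> F n"
        using e k by (auto simp: subset_iff dist_norm)
      then show "norm (cinner (a + k) h) \<le> real n" "norm (cinner a h) \<le> real n"
        using h by (auto simp: F_def)
    qed
    finally show ?thesis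
      using e(1) by (simp add: field_simps)
  qed (use e(1) in simp)
  then show ?thesis
    by blast
qed

section \<open>Adjoints of linear relations\<close>

lemma mem_radj_iff: "(g, g') \<in> radj R \<longleftrightarrow> (\<forall>f f'. (f, f') \<in> R \<longrightarrow> cinner f' g = cinner f g')"
  by (auto simp: radj_def)

text \<open>This rotation carries facts about complements, such as closedness and the double
  complement theorem, over to adjoints.\<close>

lemma radj_iff_orth: "(g, g') \<in> radj R \<longleftrightarrow> (- g', g) \<in> orth R"
  by (fastforce simp: mem_radj_iff orth_def cinner_prod_def)

lemma closed_radj: "closed (radj R)"
proof -
  have "radj R = (\<lambda>p. (- snd p, fst p)) -` orth R"
    by (auto simp: radj_iff_orth)
  also have "closed \<dots>"
    by (intro continuous_closed_vimage closed_orth continuous_intros)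
  finally show ?thesis .
qed

lemma linear_relation_radj: "linear_relation (radj R)"
  unfolding linear_relation_def
  by (rule cvec.subspaceI)
    (auto simp: mem_radj_iff cscale_prod_def cinner_simps zero_prod_def)

lemma radj_anti_mono: "R \<subseteq> S \<Longrightarrow> radj S \<subseteq> radj R"
  by (auto simp: radj_def)

text \<open>The rotations from the two adjoints compose to a change of sign, which leaves
  complements invariant, so the double complement remains.\<close>

lemma radj_radj:
  assumes "linear_relation R"
  shows "radj (radj R) = closure R"
proof -
  have "(f, f') \<in> radj (radj R) \<longleftrightarrow> (f, f') \<in> orth (orth R)" for f f'
  proof
    assume *: "(f, f') \<in> radj (radj R)"
    have "cinner (u, v) (f, f') = 0" if "(u, v) \<in> orth R" for u v
    proof -
      have "(v, - u) \<in> radj R"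
        using that by (simp add: radj_iff_orth)
      then have "cinner (- u) f = cinner v f'"
        using * unfolding mem_radj_iff[of f f'] by blast
      then show ?thesis
        by (simp add: cinner_prod_def neg_eq_iff_add_eq_0)
    qed
    then show "(f, f') \<in> orth (orth R)"
      by (auto simp: orth_def[of "orth R"])
  next
    assume *: "(f, f') \<in> orth (orth R)"
    have "cinner g' f = cinner g f'" if "(g, g') \<in> radj R" for g g'
    proof -
      have "cinner (- g', g) (f, f') = 0"
        using * that unfolding radj_iff_orth orth_def[of "orth R"] by blast
      then show ?thesis
        by (simp add: cinner_prod_def)
    qed
    then show "(f, f') \<in> radj (radj R)"
      by (simp add: mem_radj_iff[of f f'])
  qed
  then show ?thesis
    using orth_orth[of R] assms by (auto simp: linear_relation_def)
qed

lemma rmul_radj: "rmul (radj R) = orth (Domain R)"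
  by (auto simp: rmul_def mem_radj_iff orth_def)

lemma rker_radj: "rker (radj R) = orth (Range R)"
  by (auto simp: rker_def mem_radj_iff orth_def)

lemma linear_relation_add:
  "linear_relation R \<Longrightarrow> (x, y) \<in> R \<Longrightarrow> (u, v) \<in> R \<Longrightarrow> (x + u, y + v) \<in> R"
  unfolding linear_relation_def by (drule (2) cvec.subspace_add) simp

lemma linear_relation_diff:
  "linear_relation R \<Longrightarrow> (x, y) \<in> R \<Longrightarrow> (u, v) \<in> R \<Longrightarrow> (x - u, y - v) \<in> R"
  unfolding linear_relation_def by (drule (2) cvec.subspace_diff) simp

lemma linear_relation_scale:
  "linear_relation R \<Longrightarrow> (x, y) \<in> R \<Longrightarrow> (a *\<^sub>c x, a *\<^sub>c y) \<in> R"
  unfolding linear_relation_def by (drule cvec.subspace_scale[where c = a]) (auto simp: cscale_prod_def)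

lemma linear_relation_zero: "linear_relation R \<Longrightarrow> (0, 0) \<in> R"
  unfolding linear_relation_def by (drule cvec.subspace_0) (simp add: zero_prod_def)

lemma linear_relationI:
  assumes "(0, 0) \<in> R"
    and "\<And>x y u v. (x, y) \<in> R \<Longrightarrow> (u, v) \<in> R \<Longrightarrow> (x + u, y + v) \<in> R"
    and "\<And>a x y. (x, y) \<in> R \<Longrightarrow> (a *\<^sub>c x, a *\<^sub>c y) \<in> R"
  shows "linear_relation R"
  unfolding linear_relation_def
  by (rule cvec.subspaceI) (use assms in \<open>auto simp: zero_prod_def cscale_prod_def\<close>)

lemma linear_relation_converse: "linear_relation R \<Longrightarrow> linear_relation (R\<inverse>)"
  by (rule linear_relationI)
    (auto intro: linear_relation_add linear_relation_scale linear_relation_zero)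

lemma linear_relation_relcomp:
  assumes "linear_relation R" "linear_relation Q"
  shows "linear_relation (R O Q)"
proof (rule linear_relationI)
  show "(0, 0) \<in> R O Q"
    using assms by (blast intro: linear_relation_zero)
  show "(x + u, y + v) \<in> R O Q" if "(x, y) \<in> R O Q" "(u, v) \<in> R O Q" for x y u v
    using that assms by (blast intro: linear_relation_add)
  show "(a *\<^sub>c x, a *\<^sub>c y) \<in> R O Q" if "(x, y) \<in> R O Q" for a x y
    using that assms by (blast intro: linear_relation_scale)
qed

lemma csubspace_Domain:
  assumes "linear_relation R"
  shows "cvec.subspace (Domain R)"
  by (rule cvec.subspaceI)
    (use assms in \<open>blast intro: linear_relation_add linear_relation_scale linear_relation_zero\<close>)+

lemma csubspace_Range:
  assumes "linear_relation R"
  shows "cvec.subspace (Range R)"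
  using csubspace_Domain[OF linear_relation_converse[OF assms]] by simp

lemma linear_relation_restrict:
  assumes "linear_relation R" "cvec.subspace S"
  shows "linear_relation (rrestrict R S)"
  using assms unfolding rrestrict_def
  by (intro linear_relationI)
    (auto intro: linear_relation_add linear_relation_scale linear_relation_zero
      cvec.subspace_0 cvec.subspace_add cvec.subspace_scale)

text \<open>The closure is the double adjoint, so its multivalued part and its kernel are
  complements of the domain and the range of the adjoint.\<close>

lemma rmul_closure: "linear_relation R \<Longrightarrow> rmul (closure R) = orth (Domain (radj R))"
  by (simp add: radj_radj[symmetric] rmul_radj)

lemma rker_closure: "linear_relation R \<Longrightarrow> rker (closure R) = orth (Range (radj R))"
  by (simp add: radj_radj[symmetric] rker_radj)

lemma operator_linear: "is_operator R \<Longrightarrow> linear_relation R"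
  by (simp add: is_operator_def)

lemma operator_unique:
  assumes "is_operator R" "(x, y) \<in> R" "(x, y') \<in> R"
  shows "y = y'"
proof -
  have "y - y' \<in> rmul R"
    using linear_relation_diff[OF operator_linear[OF assms(1)] assms(2,3)] by (simp add: rmul_def)
  then show ?thesis
    using assms(1) by (simp add: is_operator_def)
qed

lemma operator_zero: "is_operator R \<Longrightarrow> (0, y) \<in> R \<Longrightarrow> y = 0"
  unfolding is_operator_def rmul_def by blast

lemma rker_unique:
  assumes "linear_relation R" "rker R = {0}" "(x, y) \<in> R" "(x', y) \<in> R"
  shows "x = x'"
proof -
  have "x - x' \<in> rker R"
    using linear_relation_diff[OF assms(1,3,4)] by (simp add: rker_def)
  then show ?thesis
    using assms(2) by simp
qed

lemma is_operatorI:
  assumes "linear_relation R" "\<And>y. (0, y) \<in> R \<Longrightarrow> y = 0"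
  shows "is_operator R"
  unfolding is_operator_def rmul_def using assms linear_relation_zero[OF assms(1)] by blast

lemma is_operator_radj:
  assumes "linear_relation R" "densely_defined R"
  shows "is_operator (radj R)"
proof -
  have "rmul (radj R) = {0}"
    using closure_eq_UNIV_iff_orth[OF csubspace_Domain[OF assms(1)]] assms(2)
    by (simp add: rmul_radj densely_defined_def)
  then show ?thesis
    by (simp add: is_operator_def linear_relation_radj)
qed

text \<open>As both factors contain 0, the pairs \<open>(x, 0)\<close> and \<open>(0, y)\<close>
  test the two components separately; the factors come out crossed.\<close>

lemma radj_times:
  assumes "0 \<in> A" "0 \<in> B"
  shows "radj (A \<times> B) = orth B \<times> orth A"
proof -
  have "(g, g') \<in> radj (A \<times> B) \<longleftrightarrow> g \<in> orth B \<and> g' \<in> orth A" for g g'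
  proof
    assume *: "(g, g') \<in> radj (A \<times> B)"
    have "cinner y g = 0" if "y \<in> B" for y
      using * assms that unfolding mem_radj_iff by fastforce
    moreover have "cinner x g' = 0" if "x \<in> A" for x
      using * assms that unfolding mem_radj_iff by fastforce
    ultimately show "g \<in> orth B \<and> g' \<in> orth A"
      by (simp add: orth_def)
  next
    assume "g \<in> orth B \<and> g' \<in> orth A"
    then show "(g, g') \<in> radj (A \<times> B)"
      by (simp add: mem_radj_iff orth_def)
  qed
  then show ?thesis
    by auto
qed

section \<open>Symmetric and self-adjoint relations off the real axis\<close>

lemma symmetric_Im:
  assumes "symmetric_rel A" "(f, f') \<in> A"
  shows "\<bar>Im z\<bar> * norm f \<le> norm (f' - z *\<^sub>c f)"
proof (cases "f = 0")
  case False
  \<comment> \<open>Symmetry makes \<open>cinner f' f\<close> real, so only the term with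
    \<open>z\<close> contributes to the imaginary part estimated below.\<close>
  have "cinner f' f = cinner f f'"
    using assms by (auto simp: symmetric_rel_def mem_radj_iff)
  then have "cinner f' f = cnj (cinner f' f)"
    by (subst (2) cinner_commute) simp
  then have "Im (cinner f' f) = 0"
    by (simp add: complex_eq_iff)
  then have "\<bar>Im z\<bar> * (norm f)\<^sup>2 = \<bar>Im (cinner (f' - z *\<^sub>c f) f)\<bar>"
    by (simp add: cinner_simps cinner_self abs_mult)
  also have "\<dots> \<le> norm (f' - z *\<^sub>c f) * norm f"
    using abs_Im_le_cmod norm_cinner_le order_trans by blast
  finally show ?thesis
    using False by (simp add: power2_eq_square)
qed simp

lemma symmetric_eigenvector_zero:
  assumes "symmetric_rel A" "(f, z *\<^sub>c f) \<in> A" "z \<notin> \<real>"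
  shows "f = 0"
  using symmetric_Im[OF assms(1,2), of z] assms(3)
  by (auto simp: complex_is_Real_iff mult_le_0_iff)

text \<open>The range \<open>S\<close> of \<open>A - z\<close> is closed by the estimate
  \<open>symmetric_Im\<close>. It is dense because a vector orthogonal to it is an eigenvector of
  \<open>radj A = A\<close> at the non-real number \<open>cnj z\<close>, hence zero.\<close>

lemma selfadjoint_range:
  assumes "selfadjoint_rel A" "z \<notin> \<real>"
  shows "\<exists>f. (f, z *\<^sub>c f + h) \<in> A"
proof -
  define S where "S = (\<lambda>p. snd p - z *\<^sub>c fst p) ` A"
  have A: "radj A = A" "symmetric_rel A" "linear_relation A" "closed A"
    using assms(1) linear_relation_radj[of A] closed_radj[of A]
    by (simp_all add: selfadjoint_rel_def symmetric_rel_def)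
  have Im: "\<bar>Im z\<bar> > 0"
    using assms(2) by (simp add: complex_is_Real_iff)
  have S: "cvec.subspace S"
  proof (rule cvec.subspaceI)
    show "0 \<in> S"
      using linear_relation_zero[OF A(3)] by (force simp: S_def)
    show "x + y \<in> S" if "x \<in> S" "y \<in> S" for x y
    proof -
      from that obtain f f' g g' where "(f, f') \<in> A" "x = f' - z *\<^sub>c f" "(g, g') \<in> A" "y = g' - z *\<^sub>c g"
        by (auto simp: S_def)
      moreover from this have "(f + g, f' + g') \<in> A"
        using A(3) by (blast intro: linear_relation_add)
      ultimately show ?thesis
        unfolding S_def by (force simp: cscale_add_right)
    qed
    show "a *\<^sub>c x \<in> S" if "x \<in> S" for a x
    proof -
      from that obtain f f' where "(f, f') \<in> A" "x = f' - z *\<^sub>c f"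
        by (auto simp: S_def)
      moreover from this have "(a *\<^sub>c f, a *\<^sub>c f') \<in> A"
        using A(3) by (blast intro: linear_relation_scale)
      ultimately show ?thesis
        unfolding S_def
        by (intro rev_image_eqI[of "(a *\<^sub>c f, a *\<^sub>c f')"])
          (auto simp: cvec.scale_right_diff_distrib mult.commute)
    qed
  qed
  have "closed S"
    unfolding closed_sequential_limits
  proof (intro allI impI, elim conjE)
    fix s x assume "\<forall>n. s n \<in> S" and lim: "s \<longlonglongrightarrow> x"
    then have "\<forall>n. \<exists>p\<in>A. s n = snd p - z *\<^sub>c fst p"
      unfolding S_def by blast
    then obtain p where p: "\<And>n. p n \<in> A" "\<And>n. s n = snd (p n) - z *\<^sub>c fst (p n)"
      by metis
    define u v where "u n = fst (p n)" and "v n = snd (p n)" for n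
    have uv: "(u n, v n) \<in> A" "s n = v n - z *\<^sub>c u n" for n
      using p by (simp_all add: u_def v_def)
    \<comment> \<open>The first components are controlled by \<open>s\<close>; the second ones then
      converge as \<open>s n + z *\<^sub>c u n\<close>, and closedness of \<open>A\<close> catches
      the limit.\<close>
    have "norm (u m - u n) \<le> 1 / \<bar>Im z\<bar> * norm (s m - s n)" for m n
      using symmetric_Im[OF A(2) linear_relation_diff[OF A(3) uv(1)[of m] uv(1)[of n]], of z] Im
      by (simp add: uv(2) field_simps cvec.scale_right_diff_distrib)
    then have "Cauchy u"
      by (rule Cauchy_dominated[OF LIMSEQ_imp_Cauchy[OF lim]])
    then obtain f where f: "u \<longlonglongrightarrow> f"
      using Cauchy_convergent_iff convergent_def by blast
    have "(\<lambda>n. s n + z *\<^sub>c u n) \<longlonglongrightarrow> x + z *\<^sub>c f"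
      by (intro tendsto_add lim tendsto_cscale f)
    then have "(\<lambda>n. (u n, v n)) \<longlonglongrightarrow> (f, x + z *\<^sub>c f)"
      by (intro tendsto_Pair f) (simp add: uv(2))
    then have "(f, x + z *\<^sub>c f) \<in> A"
      by (rule closed_sequentially[OF A(4), rotated]) (rule uv(1))
    then show "x \<in> S"
      unfolding S_def by (rule rev_image_eqI) simp
  qed
  moreover have "orth S = {0}"
  proof -
    have "g = 0" if "g \<in> orth S" for g
    proof -
      have "(g, cnj z *\<^sub>c g) \<in> radj A"
        unfolding mem_radj_iff
      proof (intro allI impI)
        fix f f' assume "(f, f') \<in> A"
        then have "f' - z *\<^sub>c f \<in> S"
          by (force simp: S_def)
        then have "cinner (f' - z *\<^sub>c f) g = 0"
          using that by (simp add: orth_def)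
        then show "cinner f' g = cinner f (cnj z *\<^sub>c g)"
          by (simp add: cinner_simps)
      qed
      then show ?thesis
        using symmetric_eigenvector_zero[OF A(2)] A(1) assms(2) by (simp add: complex_is_Real_iff)
    qed
    then show ?thesis
      by (auto simp: orth_def)
  qed
  ultimately have "h \<in> S"
    using closure_eq_UNIV_iff_orth[OF S] by (simp add: closure_closed)
  then obtain f f' where "(f, f') \<in> A" "h = f' - z *\<^sub>c f"
    by (auto simp: S_def)
  then show ?thesis
    by (metis add.commute diff_add_cancel)
qed

section \<open>Green's identity and boundary triples\<close>

definition green :: "'a::chilbert \<times> 'b::chilbert \<Rightarrow> 'b \<times> 'a \<Rightarrow> complex" where
  "green p q = cinner (snd p) (fst q) - cinner (fst p) (snd q)"

lemma green_Pair: "green (f, f') (g, g') = cinner f' g - cinner f g'"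
  by (simp add: green_def)

lemma green_zero [simp]: "green 0 q = 0" "green p 0 = 0"
  by (simp_all add: green_def)

lemma green_eq_cinner: "green p q = cinner (snd p, - fst p) q"
  by (simp add: green_def cinner_prod_def)

lemma mem_radj_iff_green: "q \<in> radj R \<longleftrightarrow> (\<forall>p\<in>R. green p q = 0)"
  by (cases q) (auto simp: mem_radj_iff green_Pair)

text \<open>Pairing with a vector rotated by \<open>Jop\<close> is \<open>- \<i>\<close> times the
  form \<open>green\<close>; the same factor appears in both spaces and cancels.\<close>

lemma mem_rsharp_iff: "(u, h) \<in> rsharp \<Gamma> \<longleftrightarrow> (\<forall>(f, l)\<in>\<Gamma>. green f u = green l h)"
proof -
  obtain u1 u2 h1 h2 where uh: "u = (u1, u2)" "h = (h1, h2)"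
    by (metis surj_pair)
  have green: "cinner p (- (\<i> *\<^sub>c b), \<i> *\<^sub>c a) = - (\<i> * green p (a, b))"
    for p :: "'x::chilbert \<times> 'x" and a b
    by (simp add: cinner_prod_def cinner_simps green_def algebra_simps)
  have "(u, h) \<in> rsharp \<Gamma> \<longleftrightarrow> (h, u) \<in> Jop O radj \<Gamma> O Jop"
    by (simp add: rsharp_def rplus_def)
  also have "\<dots> \<longleftrightarrow> ((- (\<i> *\<^sub>c h2), \<i> *\<^sub>c h1), (- (\<i> *\<^sub>c u2), \<i> *\<^sub>c u1)) \<in> radj \<Gamma>"
  proof -
    have J: "((a, b), (u1, u2)) \<in> Jop \<longleftrightarrow> a = - (\<i> *\<^sub>c u2) \<and> b = \<i> *\<^sub>c u1" for a b
      by (auto simp: Jop_def)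
    have "((h1, h2), q) \<in> Jop \<longleftrightarrow> q = (- (\<i> *\<^sub>c h2), \<i> *\<^sub>c h1)" for q
      by (auto simp: Jop_def)
    with J show ?thesis
      unfolding uh by (auto simp: relcomp_unfold)
  qed
  also have "\<dots> \<longleftrightarrow> (\<forall>(f, l)\<in>\<Gamma>. green f u = green l h)"
    unfolding uh mem_radj_iff green by auto
  finally show ?thesis .
qed

text \<open>For \<open>h = 0\<close> the boundary side of Green's identity vanishes, which leaves
  the adjoint condition against the domain.\<close>

lemma rker_rsharp: "rker (rsharp \<Gamma>) = radj (Domain \<Gamma>)"
proof -
  have "u \<in> rker (rsharp \<Gamma>) \<longleftrightarrow> u \<in> radj (Domain \<Gamma>)" for u
    unfolding rker_def mem_rsharp_iff mem_radj_iff_green mem_Collect_eq green_zero by blast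
  then show ?thesis
    by blast
qed

lemma closed_rsharp: "closed (rsharp \<Gamma>)"
proof -
  have "rsharp \<Gamma> = (\<Inter>(f, l)\<in>\<Gamma>. {p. green f (fst p) = green l (snd p)})"
    by (rule set_eqI, simp only: split_paired_all mem_rsharp_iff) auto
  also have "closed \<dots>"
    unfolding green_eq_cinner split_beta
    by (intro closed_INT ballI closed_Collect_eq continuous_intros)
  finally show ?thesis .
qed

section \<open>Ordinary boundary triples and preimages under \<Gamma>\<close>

locale ordinary_triple =
  fixes T :: "('a::chilbert \<times> 'a) set" and \<Gamma> :: "(('a \<times> 'a) \<times> ('b::chilbert \<times> 'b)) set"
  assumes ordinary: "ordinary_bt T \<Gamma>"
begin

lemma operator: "is_operator \<Gamma>"
  and rsharp_eq: "rsharp \<Gamma> = \<Gamma>"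
  and surjective: "Range \<Gamma> = UNIV"
  and T_eq: "T = rker \<Gamma>"
  using ordinary by (auto simp: ordinary_bt_def isometric_bt_def)

lemmas linear = operator_linear[OF operator]
lemmas unique = operator_unique[OF operator]

lemma mem_iff: "(u, h) \<in> \<Gamma> \<longleftrightarrow> (\<forall>(f, l)\<in>\<Gamma>. green f u = green l h)"
  using mem_rsharp_iff[of u h \<Gamma>] by (simp add: rsharp_eq)

lemma green_identity: "(f, l) \<in> \<Gamma> \<Longrightarrow> (u, h) \<in> \<Gamma> \<Longrightarrow> green f u = green l h"
  using mem_iff by blast

text \<open>Since \<open>\<Gamma>\<close> is onto, Green's identity bounds \<open>\<Gamma>\<close> weakly on the unit ball of its domain.\<close>

lemma bounded: "\<exists>c. \<forall>(u, h)\<in>\<Gamma>. norm h \<le> c * norm u"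
proof -
  define B where "B = {h. \<exists>u. (u, h) \<in> \<Gamma> \<and> norm u \<le> 1}"
  have "\<exists>c. \<forall>h\<in>B. norm (cinner l h) \<le> c" for l
  proof -
    \<comment> \<open>The boundary value is \<open>l\<close> rotated, so that the boundary form
      against \<open>h\<close> becomes \<open>cinner l h\<close>.\<close>
    obtain f where f: "(f, (- snd l, fst l)) \<in> \<Gamma>"
      using surjective by (metis Range_iff UNIV_I)
    have "norm (cinner l h) \<le> norm (snd f, - fst f)" if "h \<in> B" for h
    proof -
      obtain u where u: "(u, h) \<in> \<Gamma>" "norm u \<le> 1"
        using \<open>h \<in> B\<close> by (auto simp: B_def)
      have "cinner l h = cinner (snd f, - fst f) u"
        using green_identity[OF f u(1)] by (simp add: green_eq_cinner)
      also have "norm \<dots> \<le> norm (snd f, - fst f) * norm u"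
        by (rule norm_cinner_le)
      also have "\<dots> \<le> norm (snd f, - fst f)"
        using u(2) by (intro mult_left_le) auto
      finally show ?thesis .
    qed
    then show ?thesis
      by blast
  qed
  from uniform_boundedness[OF this] obtain c where c: "\<And>h. h \<in> B \<Longrightarrow> norm h \<le> c"
    by blast
  have "norm h \<le> c * norm u" if uh: "(u, h) \<in> \<Gamma>" for u h
  proof (cases "u = 0")
    \<comment> \<open>Rescaling to the unit ball is impossible here; instead single-valuedness of
      \<Gamma> forces \<open>h = 0\<close>.\<close>
    case True
    then show ?thesis
      using operator_zero[OF operator] uh by simp
  next
    case False
    define a where "a = complex_of_real (1 / norm u)"
    have "(a *\<^sub>c u, a *\<^sub>c h) \<in> \<Gamma>"
      using linear uh by (rule linear_relation_scale)
    moreover have "norm (a *\<^sub>c u) \<le> 1"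
      using False by (simp add: a_def norm_cscale norm_divide)
    ultimately have "norm (a *\<^sub>c h) \<le> c"
      by (intro c) (unfold B_def, blast)
    then show ?thesis
      using False by (simp add: a_def norm_cscale norm_divide field_simps)
  qed
  then show ?thesis
    by blast
qed

text \<open>By \<open>bounded\<close>, the boundary values of a convergent sequence are Cauchy, and
  \<Gamma> is closed since it equals \<open>rsharp \<Gamma>\<close>.\<close>

lemma closed_Domain: "closed (Domain \<Gamma>)"
  unfolding closed_sequential_limits
proof (intro allI impI, elim conjE)
  fix u f assume "\<forall>n. u n \<in> Domain \<Gamma>" and lim: "u \<longlonglongrightarrow> f"
  then have "\<forall>n. \<exists>h. (u n, h) \<in> \<Gamma>"
    by (simp add: Domain_iff)
  then obtain h where h: "\<And>n. (u n, h n) \<in> \<Gamma>"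
    by metis
  obtain c where "\<And>u h. (u, h) \<in> \<Gamma> \<Longrightarrow> norm h \<le> c * norm u"
    using bounded by blast
  then have "norm (h m - h n) \<le> c * norm (u m - u n)" for m n
    using linear_relation_diff[OF linear h h] by blast
  then have "Cauchy h"
    by (rule Cauchy_dominated[OF LIMSEQ_imp_Cauchy[OF lim]])
  then obtain l where "h \<longlonglongrightarrow> l"
    using Cauchy_convergent_iff convergent_def by blast
  then have "(\<lambda>n. (u n, h n)) \<longlonglongrightarrow> (f, l)"
    by (intro tendsto_Pair lim)
  moreover have "closed \<Gamma>"
    using closed_rsharp[of \<Gamma>] by (simp add: rsharp_eq)
  ultimately have "(f, l) \<in> \<Gamma>"
    using closed_sequentially[of \<Gamma> "\<lambda>n. (u n, h n)"] h by blast
  then show "f \<in> Domain \<Gamma>"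
    by blast
qed

text \<open>\<open>T\<close> is the adjoint of the domain, so its own adjoint is the closure of the
  domain, which is already closed.\<close>

lemma Domain_eq: "Domain \<Gamma> = radj T"
proof -
  have "T = radj (Domain \<Gamma>)"
    using rker_rsharp[of \<Gamma>] T_eq by (simp add: rsharp_eq)
  then show ?thesis
    using radj_radj[of "Domain \<Gamma>"] csubspace_Domain[OF linear] closed_Domain
    by (simp add: linear_relation_def closure_closed)
qed

text \<open>From \<open>0 \<in> L\<close> it follows that \<open>T\<close> lies in the preimage,
  whence the adjoint lies in the domain of \<Gamma>. There Green's identity transfers the condition
  to the boundary, and surjectivity ensures that every element of \<open>L\<close> is
  tested.\<close>

lemma radj_preimage:
  assumes "0 \<in> L"
  shows "radj (\<Gamma>\<inverse> `` L) = \<Gamma>\<inverse> `` radj L"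
proof -
  have T: "T \<subseteq> \<Gamma>\<inverse> `` L"
    using assms by (auto simp: T_eq rker_def)
  have "u \<in> radj (\<Gamma>\<inverse> `` L) \<longleftrightarrow> h \<in> radj L" if "(u, h) \<in> \<Gamma>" for u h
  proof -
    have "u \<in> radj (\<Gamma>\<inverse> `` L) \<longleftrightarrow> (\<forall>l\<in>L. \<forall>f. (f, l) \<in> \<Gamma> \<longrightarrow> green f u = 0)"
      by (auto simp: mem_radj_iff_green)
    also have "\<dots> \<longleftrightarrow> (\<forall>l\<in>L. \<forall>f. (f, l) \<in> \<Gamma> \<longrightarrow> green l h = 0)"
      using green_identity[OF _ that] by fastforce
    also have "\<dots> \<longleftrightarrow> h \<in> radj L"
      unfolding mem_radj_iff_green using surjective by (metis Range_iff UNIV_I)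
    finally show ?thesis .
  qed
  moreover have "radj (\<Gamma>\<inverse> `` L) \<subseteq> Domain \<Gamma>"
    unfolding Domain_eq using T by (rule radj_anti_mono)
  ultimately show ?thesis
    by blast
qed

text \<open>Single-valuedness lets the two components, found separately, be joined into one boundary
  value.\<close>

lemma preimage_times:
  "{f \<in> radj T. \<exists>l\<in>L. \<exists>l'\<in>L'. (f, l) \<in> bfst \<Gamma> \<and> (f, l') \<in> bsnd \<Gamma>} = \<Gamma>\<inverse> `` (L \<times> L')"
proof -
  have "(f, l) \<in> bfst \<Gamma> \<and> (f, l') \<in> bsnd \<Gamma> \<longleftrightarrow> (f, (l, l')) \<in> \<Gamma>" for f l l'
    by (auto simp: bfst_def bsnd_def dest: unique)
  then show ?thesis
    by (auto simp: Domain_eq[symmetric])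
qed

lemma rker_bfst: "rker (bfst \<Gamma>) = \<Gamma>\<inverse> `` ({0} \<times> UNIV)"
  by (auto simp: rker_def bfst_def)

text \<open>The relation \<open>{0} \<times> UNIV\<close> in the boundary space is its own
  adjoint.\<close>

lemma selfadjoint_rker_bfst: "selfadjoint_rel (rker (bfst \<Gamma>))"
  unfolding selfadjoint_rel_def rker_bfst
  by (subst radj_preimage) (auto simp: radj_times orth_UNIV orth_zero zero_prod_def)

text \<open>Start from any element with boundary value \<open>(l, 0)\<close> and subtract an element
  of the self-adjoint \<open>ker \<Gamma>\<^sub>0\<close> with the same image under second minus
  \<open>z\<close> times first component. The difference is an eigenvector with the same first
  boundary value \<open>l\<close>.\<close>

lemma weyl_total:
  assumes "z \<notin> \<real>"
  shows "\<exists>l'. (l, l') \<in> weyl_family \<Gamma> z"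
proof -
  obtain g g' where g: "((g, g'), (l, 0)) \<in> \<Gamma>"
    using surjective by (metis Range_iff UNIV_I surj_pair)
  obtain f where "(f, z *\<^sub>c f + (g' - z *\<^sub>c g)) \<in> rker (bfst \<Gamma>)"
    using selfadjoint_range[OF selfadjoint_rker_bfst assms] by blast
  then obtain k where "((f, z *\<^sub>c f + (g' - z *\<^sub>c g)), (0, k)) \<in> \<Gamma>"
    by (auto simp: rker_def bfst_def)
  then have "((g - f, z *\<^sub>c (g - f)), (l, - k)) \<in> \<Gamma>"
    using linear_relation_diff[OF linear g] by (fastforce simp: cvec.scale_right_diff_distrib)
  then show ?thesis
    by (auto simp: weyl_family_def)
qed

lemma isometric_bt_relcomp:
  assumes V: "is_operator V" "V \<subseteq> rsharp V"
    and symmetric: "radj (Domain V) \<subseteq> radj (radj (Domain V))"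
  shows "isometric_bt (\<Gamma>\<inverse> `` radj (Domain V)) (\<Gamma> O V)"
proof -
  let ?S = "\<Gamma>\<inverse> `` radj (Domain V)"
  have "0 \<in> Domain V"
    using csubspace_Domain[OF operator_linear[OF V(1)]] by (rule cvec.subspace_0)
  then have S: "?S = radj (\<Gamma>\<inverse> `` Domain V)"
    by (simp add: radj_preimage)
  have "0 \<in> radj (Domain V)"
    by (simp add: mem_radj_iff_green)
  then have "symmetric_rel ?S"
    unfolding symmetric_rel_def radj_preimage[OF \<open>0 \<in> radj (Domain V)\<close>]
    using symmetric by (intro Image_mono order_refl)
  then have "closed_symmetric ?S"
    unfolding closed_symmetric_def S by (simp add: linear_relation_radj closed_radj)
  moreover have "is_operator (\<Gamma> O V)"
  proof (rule is_operatorI)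
    show "linear_relation (\<Gamma> O V)"
      by (intro linear_relation_relcomp linear operator_linear V)
    fix y assume "(0, y) \<in> \<Gamma> O V"
    then obtain l where "(0, l) \<in> \<Gamma>" "(l, y) \<in> V"
      by blast
    then show "y = 0"
      using operator_zero[OF operator] operator_zero[OF V(1)] by blast
  qed
  moreover have "\<Gamma> O V \<subseteq> rsharp (\<Gamma> O V)"
  proof -
    have "green f u = green l' h'"
      if "(f, l) \<in> \<Gamma>" "(l, l') \<in> V" "(u, h) \<in> \<Gamma>" "(h, h') \<in> V" for f l l' u h h'
    proof -
      have "(h, h') \<in> rsharp V"
        using that(4) V(2) by blast
      then have "green l h = green l' h'"
        using that(2) unfolding mem_rsharp_iff by blast
      then show ?thesis
        using green_identity[OF that(1,3)] by simp
    qed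
    then show ?thesis
      by (intro subrelI) (unfold mem_rsharp_iff, blast)
  qed
  moreover have "Domain (\<Gamma> O V) = \<Gamma>\<inverse> `` Domain V"
    by blast
  then have "?S = rker (rsharp (\<Gamma> O V))"
    by (simp add: rker_rsharp S)
  ultimately show ?thesis
    by (simp add: isometric_bt_def)
qed

end

section \<open>The block operator and the transformed triple\<close>

lemma Domain_rrestrict: "Domain (rrestrict R S) = Domain R \<inter> S"
  by (auto simp: rrestrict_def)

lemma mem_rrestrict: "(x, y) \<in> rrestrict R S \<longleftrightarrow> (x, y) \<in> R \<and> x \<in> S"
  by (simp add: rrestrict_def)

lemma linear_relation_weyl_family:
  assumes "linear_relation R"
  shows "linear_relation (weyl_family R z)"
proof (rule linear_relationI)
  show "(0, 0) \<in> weyl_family R z"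
    using linear_relation_zero[OF assms] unfolding weyl_family_def
    by (auto simp: zero_prod_def intro!: exI[of _ 0])
  show "(x + u, y + v) \<in> weyl_family R z"
    if "(x, y) \<in> weyl_family R z" "(u, v) \<in> weyl_family R z" for x y u v
  proof -
    from that obtain f g where "((f, z *\<^sub>c f), (x, y)) \<in> R" "((g, z *\<^sub>c g), (u, v)) \<in> R"
      by (auto simp: weyl_family_def)
    from linear_relation_add[OF assms this] show ?thesis
      unfolding weyl_family_def by (auto simp: cscale_add_right[symmetric])
  qed
  show "(a *\<^sub>c x, a *\<^sub>c y) \<in> weyl_family R z" if "(x, y) \<in> weyl_family R z" for a x y
  proof -
    from that obtain f where "((f, z *\<^sub>c f), (x, y)) \<in> R"
      by (auto simp: weyl_family_def)
    from linear_relation_scale[OF assms this, of a] show ?thesis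
      unfolding weyl_family_def by (auto simp: cscale_prod_def mult.commute intro!: exI[of _ "a *\<^sub>c f"])
  qed
qed

section \<open>The block operator: isometry, adjoint of its domain, density of its range\<close>

locale transform =
  fixes E G :: "('b::chilbert \<times> 'b) set"
  assumes E: "is_operator E" "symmetric_rel E"
    and G: "is_operator G" "densely_defined G" "rker G = {0}"
begin

abbreviation G\<^sub>E where "G\<^sub>E \<equiv> rrestrict G (Domain E)"
abbreviation E\<^sub>G where "E\<^sub>G \<equiv> rrestrict E (Domain G)"

lemmas linear_E = operator_linear[OF E(1)]
lemmas linear_G = operator_linear[OF G(1)]
lemmas G_inj = rker_unique[OF linear_G G(3)]
lemmas operator_radj = is_operator_radj[OF linear_G G(2)]

lemma linear_restrict: "linear_relation G\<^sub>E" "linear_relation E\<^sub>G"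
  by (simp_all add: linear_relation_restrict linear_E linear_G csubspace_Domain)

text \<open>Injectivity of \<open>G\<close> identifies the two \<open>G\<close>-preimages of
  \<open>l\<close> occurring in \<open>Vop_def\<close>.\<close>

lemma mem_Vop_iff:
  "((l, l'), (h, y)) \<in> Vop E G \<longleftrightarrow>
    (\<exists>k m. (h, l) \<in> G \<and> (h, k) \<in> E \<and> (l', m) \<in> radj G \<and> y = k + m)"
  unfolding Vop_def by (auto dest: G_inj)

lemma Vop_cases:
  assumes "(x, y) \<in> Vop E G"
  obtains l l' h k m where "x = (l, l')" "y = (h, k + m)" "(h, l) \<in> G" "(h, k) \<in> E" "(l', m) \<in> radj G"
proof -
  obtain l l' h w where xy: "x = (l, l')" "y = (h, w)"
    by (metis surj_pair)
  then obtain k m where "(h, l) \<in> G" "(h, k) \<in> E" "(l', m) \<in> radj G" "w = k + m"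
    using assms unfolding xy mem_Vop_iff by blast
  with xy that show thesis
    by blast
qed

lemma is_operator_Vop: "is_operator (Vop E G)"
proof -
  have "linear_relation (Vop E G)"
  proof (rule linear_relationI)
    show "(0, 0) \<in> Vop E G"
      unfolding zero_prod_def mem_Vop_iff
      using linear_E linear_G linear_relation_radj[of G] linear_relation_zero
      by (intro exI[of _ 0]) auto
    show "(x + u, y + v) \<in> Vop E G" if "(x, y) \<in> Vop E G" "(u, v) \<in> Vop E G" for x y u v
    proof -
      from that(1) obtain l l' h k m where 1: "x = (l, l')" "y = (h, k + m)"
        "(h, l) \<in> G" "(h, k) \<in> E" "(l', m) \<in> radj G"
        by (rule Vop_cases)
      from that(2) obtain j j' i p n where 2: "u = (j, j')" "v = (i, p + n)"
        "(i, j) \<in> G" "(i, p) \<in> E" "(j', n) \<in> radj G"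
        by (rule Vop_cases)
      have "(h + i, l + j) \<in> G" "(h + i, k + p) \<in> E" "(l' + j', m + n) \<in> radj G"
        using 1 2 linear_E linear_G linear_relation_radj linear_relation_add by blast+
      moreover have "k + m + (p + n) = (k + p) + (m + n)"
        by simp
      ultimately show ?thesis
        unfolding 1 2 add_Pair mem_Vop_iff by blast
    qed
    show "(a *\<^sub>c x, a *\<^sub>c y) \<in> Vop E G" if "(x, y) \<in> Vop E G" for a x y
    proof -
      from that obtain l l' h k m where 1: "x = (l, l')" "y = (h, k + m)"
        "(h, l) \<in> G" "(h, k) \<in> E" "(l', m) \<in> radj G"
        by (rule Vop_cases)
      have "(a *\<^sub>c h, a *\<^sub>c l) \<in> G" "(a *\<^sub>c h, a *\<^sub>c k) \<in> E" "(a *\<^sub>c l', a *\<^sub>c m) \<in> radj G"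
        using 1 linear_E linear_G linear_relation_radj linear_relation_scale by blast+
      then show ?thesis
        unfolding 1 cscale_prod_def fst_conv snd_conv mem_Vop_iff cscale_add_right by blast
    qed
  qed
  \<comment> \<open>The three entries vanish in turn: \<open>h\<close> since \<open>G\<close> is
    injective, \<open>k\<close> since \<open>E\<close> is an operator, \<open>m\<close> since the
    adjoint of the densely defined \<open>G\<close> is an operator.\<close>
  moreover have "y = 0" if "(0, y) \<in> Vop E G" for y
  proof -
    from that obtain h k m where y: "y = (h, k + m)" "(h, 0) \<in> G" "(h, k) \<in> E" "(0, m) \<in> radj G"
      by (rule Vop_cases) (simp add: zero_prod_def)
    have "h = 0"
      using y(2) G(3) unfolding rker_def by blast
    moreover from this have "k = 0"
      using y(3) operator_zero[OF E(1)] by blast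
    moreover have "m = 0"
      using y(4) operator_zero[OF operator_radj] by blast
    ultimately show ?thesis
      using y(1) by (simp add: zero_prod_def)
  qed
  ultimately show ?thesis
    by (rule is_operatorI)
qed

text \<open>The contributions of \<open>E\<close> cancel by symmetry; the mixed terms match by the
  duality of \<open>G\<close> and \<open>radj G\<close>.\<close>

lemma Vop_isometric: "Vop E G \<subseteq> rsharp (Vop E G)"
proof -
  have "green q q' = green p p'" if "(q, p) \<in> Vop E G" "(q', p') \<in> Vop E G" for p q p' q'
  proof -
    from that(1) obtain l l' h k m where 1: "q = (l, l')" "p = (h, k + m)"
        "(h, l) \<in> G" "(h, k) \<in> E" "(l', m) \<in> radj G"
      by (rule Vop_cases)
    from that(2) obtain j j' i e n where 2: "q' = (j, j')" "p' = (i, e + n)"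
        "(i, j) \<in> G" "(i, e) \<in> E" "(j', n) \<in> radj G"
      by (rule Vop_cases)
    have "cinner k i = cinner h e"
      using E(2) 1(4) 2(4) unfolding symmetric_rel_def by (meson mem_radj_iff subsetD)
    moreover have "cinner j l' = cinner i m"
      using 1(5) 2(3) unfolding mem_radj_iff by blast
    then have "cinner l' j = cinner m i"
      by (subst (1 2) cinner_commute) simp
    moreover have "cinner l j' = cinner h n"
      using 2(5) 1(3) unfolding mem_radj_iff by blast
    ultimately show ?thesis
      by (simp add: 1 2 green_Pair cinner_simps)
  qed
  then show ?thesis
    by (intro subrelI) (unfold mem_rsharp_iff, blast)
qed

text \<open>The domain is a product, so its adjoint is the product of the crossed complements,
  rewritten as a multivalued part and a kernel.\<close>

lemma radj_Domain_Vop: "radj (Domain (Vop E G)) = rmul (closure G) \<times> rker (radj G\<^sub>E)"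
proof -
  have "0 \<in> Range G\<^sub>E" "0 \<in> Domain (radj G)"
    using csubspace_Range[OF linear_restrict(1)] csubspace_Domain[OF linear_relation_radj]
    by (auto intro: cvec.subspace_0)
  then show ?thesis
    by (simp add: Domain_Vop radj_times rmul_closure linear_G rker_radj)
qed

lemma radj_radj_Domain_Vop:
  "radj (radj (Domain (Vop E G))) = closure (Range G\<^sub>E) \<times> closure (Domain (radj G))"
proof -
  have "0 \<in> rmul (closure G)" "0 \<in> rker (radj G\<^sub>E)"
    by (simp_all add: rmul_closure linear_G rker_radj)
  then show ?thesis
    using orth_orth[OF csubspace_Range[OF linear_restrict(1)]]
      orth_orth[OF csubspace_Domain[OF linear_relation_radj[of G]]]
    unfolding radj_Domain_Vop
    by (simp add: radj_times rmul_closure[OF linear_G] rker_radj)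
qed

text \<open>Taking orthogonal complements turns the condition on the multivalued part into
  \<open>ker G\<^sub>E\<^sup>* \<subseteq> closure (dom G\<^sup>*)\<close>, the other half of the symmetry of \<open>T'\<close>.\<close>

lemma radj_Domain_Vop_le:
  assumes "rmul (closure G) \<subseteq> closure (Range G\<^sub>E)"
  shows "radj (Domain (Vop E G)) \<subseteq> radj (radj (Domain (Vop E G)))"
proof -
  have "rker (radj G\<^sub>E) = orth (closure (Range G\<^sub>E))"
    using orth_orth[OF csubspace_orth[of "Range G\<^sub>E"]] orth_orth[OF csubspace_Range[OF linear_restrict(1)]]
    by (simp add: rker_radj closure_closed closed_orth)
  also have "\<dots> \<subseteq> orth (rmul (closure G))"
    using assms by (rule orth_anti_mono)
  also have "\<dots> = closure (Domain (radj G))"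
    using orth_orth[OF csubspace_Domain[OF linear_relation_radj[of G]]]
    by (simp add: rmul_closure linear_G)
  finally show ?thesis
    unfolding radj_radj_Domain_Vop unfolding radj_Domain_Vop using assms by blast
qed

lemma dense_if_Domain_radj_UNIV:
  assumes "closure (Range G) = UNIV" "Domain (radj G) = UNIV"
    and "rrestrict (radj E\<^sub>G) (rker (closure G)) = {(0, 0)}"
  shows "closure (Range G\<^sub>E) = UNIV" "closure (Range (Vop E G)) = UNIV"
proof -
  have inj: "x = 0 \<and> y = 0" if "x \<in> rker (closure G)" "(x, y) \<in> radj E\<^sub>G" for x y
    using assms(3) that by (auto simp: rrestrict_def)
  have ker_radj: "rker (radj G) = {0}"
    using assms(1) closure_eq_UNIV_iff_orth[OF csubspace_Range[OF linear_G]] by (simp add: rker_radj)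
  have "0 \<in> rker (closure G)"
    by (simp add: rker_closure linear_G)
  \<comment> \<open>The hypothesis at first component 0 says that \<open>radj E\<^sub>G\<close> has
    trivial multivalued part, so \<open>E\<^sub>G\<close> is densely defined.\<close>
  then have "orth (Domain E\<^sub>G) = {0}"
    using inj zero_mem_orth[of "Domain E\<^sub>G"] unfolding rmul_radj[symmetric]
    by (auto simp: rmul_def)
  moreover have "Domain E\<^sub>G = Domain G\<^sub>E"
    by (auto simp: Domain_rrestrict)
  ultimately have dom: "orth (Domain G\<^sub>E) = {0}"
    by simp
  \<comment> \<open>If \<open>y\<close> is orthogonal to \<open>Range G\<^sub>E\<close>, its image
    \<open>g\<close> under \<open>radj G\<close> is orthogonal to the dense set
    \<open>Domain G\<^sub>E\<close>. Hence \<open>y\<close> is in the kernel of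
    \<open>radj G\<close>, which is trivial as \<open>G\<close> has dense range.\<close>
  have "y = 0" if y: "y \<in> orth (Range G\<^sub>E)" for y
  proof -
    obtain g where g: "(y, g) \<in> radj G"
      using assms(2) by blast
    have "cinner h g = 0" if "h \<in> Domain G\<^sub>E" for h
    proof -
      obtain l where l: "(h, l) \<in> G" "(h, l) \<in> G\<^sub>E"
        using \<open>h \<in> Domain G\<^sub>E\<close> by (auto simp: rrestrict_def)
      then have "cinner h g = cinner l y"
        using g by (simp add: mem_radj_iff)
      also have "\<dots> = 0"
        using y l(2) unfolding orth_def by blast
      finally show ?thesis .
    qed
    then have "g \<in> orth (Domain G\<^sub>E)"
      by (simp add: orth_def)
    then have "y \<in> rker (radj G)"
      using g dom by (simp add: rker_def)
    then show ?thesis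
      using ker_radj by simp
  qed
  then have "orth (Range G\<^sub>E) = {0}"
    using zero_mem_orth by blast
  then show "closure (Range G\<^sub>E) = UNIV"
    by (simp add: closure_eq_UNIV_iff_orth csubspace_Range linear_restrict)
  have "x = 0 \<and> x' = 0" if x: "(x, x') \<in> orth (Range (Vop E G))" for x x'
  proof -
    have orth: "cinner h x + cinner (k + m) x' = 0"
      if "(h, k) \<in> E" "h \<in> Domain G" "(l', m) \<in> radj G" for h k l' m
    proof -
      have "(h, k + m) \<in> Range (Vop E G)"
        using that mem_Vop_iff by blast
      then have "cinner (h, k + m) (x, x') = 0"
        using x unfolding orth_def by blast
      then show ?thesis
        by (simp add: cinner_prod_def)
    qed
    \<comment> \<open>Setting \<open>h = k = 0\<close> isolates the entry \<open>radj G\<close>;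
      further below \<open>m = 0\<close> isolates \<open>E\<^sub>G\<close>.\<close>
    have "cinner m x' = 0" if "(l', m) \<in> radj G" for l' m
      using orth[of 0 0 l' m] that linear_relation_zero[OF linear_E] linear_relation_zero[OF linear_G]
      by auto
    then have "x' \<in> rker (closure G)"
      unfolding rker_closure[OF linear_G] orth_def by blast
    moreover have "cinner k x' = cinner h (- x)" if "(h, k) \<in> E\<^sub>G" for h k
      using orth[of h k 0 0] that linear_relation_zero[OF linear_relation_radj[of G]]
      by (simp add: rrestrict_def eq_neg_iff_add_eq_0 add.commute)
    then have "(x', - x) \<in> radj E\<^sub>G"
      by (simp add: mem_radj_iff)
    ultimately show ?thesis
      using inj[of x' "- x"] by simp
  qed
  then have "orth (Range (Vop E G)) = {0}"
    using zero_mem_orth[of "Range (Vop E G)"] by (auto simp: zero_prod_def)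
  then show "closure (Range (Vop E G)) = UNIV"
    using csubspace_Range[OF operator_linear[OF is_operator_Vop]] closure_eq_UNIV_iff_orth by blast
qed

end

lemma mem_rsum: "(x, w) \<in> rsum R S \<longleftrightarrow> (\<exists>y z. (x, y) \<in> R \<and> (x, z) \<in> S \<and> w = y + z)"
  by (auto simp: rsum_def)

lemma bfst_bpair_subset: "bfst (bpair R S) \<subseteq> R"
  by (auto simp: bfst_def bpair_def)

section \<open>The transformed triple, its Weyl function and the quasi case\<close>

locale transformed_triple = ordinary_triple T \<Gamma> + transform E G
  for T :: "('a::chilbert \<times> 'a) set" and \<Gamma> :: "(('a \<times> 'a) \<times> ('b::chilbert \<times> 'b)) set"
    and E G :: "('b \<times> 'b) set"
begin

abbreviation \<Gamma>' where "\<Gamma>' \<equiv> \<Gamma> O Vop E G"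

lemma mem_iff':
  "(f, (h, y)) \<in> \<Gamma>' \<longleftrightarrow> (\<exists>l l' k m. (f, (l, l')) \<in> \<Gamma> \<and> (h, l) \<in> G \<and> (h, k) \<in> E \<and>
    (l', m) \<in> radj G \<and> y = k + m)"
proof -
  have "(f, (h, y)) \<in> \<Gamma>' \<longleftrightarrow> (\<exists>l l'. (f, (l, l')) \<in> \<Gamma> \<and> ((l, l'), (h, y)) \<in> Vop E G)"
    by auto
  then show ?thesis
    unfolding mem_Vop_iff by blast
qed

lemma Domain_transformed: "Domain \<Gamma>' = \<Gamma>\<inverse> `` (Range G\<^sub>E \<times> Domain (radj G))"
  unfolding Domain_Vop[symmetric] by blast

text \<open>The right-hand side looks up the boundary data of \<open>f\<close> several times;
  single-valuedness of \<Gamma> and injectivity of \<open>G\<close> make these lookups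
  agree.\<close>

lemma bpair_transformed:
  fixes A'
  defines "A' \<equiv> \<Gamma>\<inverse> `` (Range G\<^sub>E \<times> Domain (radj G))"
  shows "\<Gamma>' = bpair (rrestrict (bfst \<Gamma> O G\<^sub>E\<inverse>) A')
    (rrestrict (rsum (bfst \<Gamma> O G\<^sub>E\<inverse> O E\<^sub>G) (bsnd \<Gamma> O radj G)) A')" (is "_ = bpair ?L ?R")
proof -
  have "(f, (h, y)) \<in> \<Gamma>' \<longleftrightarrow> (f, h) \<in> ?L \<and> (f, y) \<in> ?R" for f h y
  proof
    assume "(f, (h, y)) \<in> \<Gamma>'"
    then obtain l l' k m where *: "(f, (l, l')) \<in> \<Gamma>" "(h, l) \<in> G" "(h, k) \<in> E" "(l', m) \<in> radj G" "y = k + m"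
      unfolding mem_iff' by blast
    have "(f, l) \<in> bfst \<Gamma>" "(f, l') \<in> bsnd \<Gamma>" "(h, l) \<in> G\<^sub>E" "(h, k) \<in> E\<^sub>G"
      using * by (auto simp: bfst_def bsnd_def rrestrict_def)
    then have "(f, h) \<in> bfst \<Gamma> O G\<^sub>E\<inverse>" "(f, k) \<in> bfst \<Gamma> O G\<^sub>E\<inverse> O E\<^sub>G" "(f, m) \<in> bsnd \<Gamma> O radj G"
      using *(4) by auto
    moreover have "(l, l') \<in> Range G\<^sub>E \<times> Domain (radj G)"
      using *(4) \<open>(h, l) \<in> G\<^sub>E\<close> by auto
    then have "f \<in> A'"
      unfolding A'_def using *(1) by (intro ImageI[of "(l, l')"]) auto
    ultimately show "(f, h) \<in> ?L \<and> (f, y) \<in> ?R"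
      unfolding mem_rrestrict mem_rsum using *(5) by blast
  next
    assume "(f, h) \<in> ?L \<and> (f, y) \<in> ?R"
    then have "(f, h) \<in> bfst \<Gamma> O G\<^sub>E\<inverse>" "(f, y) \<in> rsum (bfst \<Gamma> O G\<^sub>E\<inverse> O E\<^sub>G) (bsnd \<Gamma> O radj G)"
      by (simp_all add: rrestrict_def)
    then obtain l h' j k l' m where *: "(f, l) \<in> bfst \<Gamma>" "(h, l) \<in> G\<^sub>E" "(f, j) \<in> bfst \<Gamma>" "(h', j) \<in> G\<^sub>E"
      "(h', k) \<in> E\<^sub>G" "(f, l') \<in> bsnd \<Gamma>" "(l', m) \<in> radj G" "y = k + m"
      unfolding mem_rsum by blast
    obtain a b c where abc: "(f, (l, a)) \<in> \<Gamma>" "(f, (j, b)) \<in> \<Gamma>" "(f, (c, l')) \<in> \<Gamma>"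
      using *(1,3,6) by (auto simp: bfst_def bsnd_def)
    have "j = l" "(f, (l, l')) \<in> \<Gamma>"
      using unique[OF abc(1,2)] unique[OF abc(1,3)] abc(1) by simp_all
    moreover from this have "h' = h"
      using *(2,4) G_inj by (auto simp: rrestrict_def)
    ultimately show "(f, (h, y)) \<in> \<Gamma>'"
      using * unfolding mem_iff' mem_rrestrict by blast
  qed
  then have "(f, p) \<in> \<Gamma>' \<longleftrightarrow> (f, p) \<in> bpair ?L ?R" for f p
    by (cases p) (simp only: bpair_def mem_Collect_eq prod.case)
  then show ?thesis
    by (intro set_eqI) (metis surj_pair)
qed

text \<open>For the harder inclusion, \<open>f\<close> has some value under \<Gamma>' by the
  restriction, and injectivity of \<open>G\<close> forces its first component to be
  \<open>h\<close>.\<close>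

lemma bfst_transformed:
  "bfst \<Gamma>' = rrestrict (bfst \<Gamma> O G\<^sub>E\<inverse>) (\<Gamma>\<inverse> `` (Range G\<^sub>E \<times> Domain (radj G)))" (is "_ = ?L")
proof
  show "bfst \<Gamma>' \<subseteq> ?L"
    unfolding bpair_transformed by (rule bfst_bpair_subset)
  show "?L \<subseteq> bfst \<Gamma>'"
  proof (rule subrelI)
    fix f h assume L: "(f, h) \<in> ?L"
    then obtain l j where lj: "(f, l) \<in> bfst \<Gamma>" "(h, l) \<in> G" "f \<in> Domain \<Gamma>'"
      unfolding Domain_transformed by (auto simp: rrestrict_def)
    then obtain i y where iy: "(f, (i, y)) \<in> \<Gamma>'"
      by (metis Domain_iff surj_pair)
    then obtain j l' where j: "(f, (j, l')) \<in> \<Gamma>" "(i, j) \<in> G"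
      unfolding mem_iff' by blast
    obtain l'' where l'': "(f, (l, l'')) \<in> \<Gamma>"
      using lj(1) unfolding bfst_def by blast
    have "j = l"
      using unique[OF j(1) l''] by simp
    then have "i = h"
      using lj(2) j(2) G_inj by blast
    then show "(f, h) \<in> bfst \<Gamma>'"
      using iy unfolding bfst_def by blast
  qed
qed

lemma weyl_transformed:
  "(h, y) \<in> weyl_family \<Gamma>' z \<longleftrightarrow> (\<exists>l l' k m. (l, l') \<in> weyl_family \<Gamma> z \<and> (h, l) \<in> G \<and>
    (h, k) \<in> E \<and> (l', m) \<in> radj G \<and> y = k + m)"
  unfolding weyl_family_def mem_Collect_eq mem_iff' by blast

lemma mem_restricted_weyl:
  "(h, k) \<in> G\<^sub>E O rrestrict (weyl_family \<Gamma> z) (Range G\<^sub>E) \<longleftrightarrow>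
    h \<in> Domain E \<and> (\<exists>l. (h, l) \<in> G \<and> (l, k) \<in> weyl_family \<Gamma> z)"
  unfolding rrestrict_def by blast

lemma weyl_transformed_eq:
  "weyl_family \<Gamma>' z = rsum E\<^sub>G (G\<^sub>E O rrestrict (weyl_family \<Gamma> z) (Range G\<^sub>E) O radj G)"
proof -
  have "(h, y) \<in> weyl_family \<Gamma>' z \<longleftrightarrow>
    (h, y) \<in> rsum E\<^sub>G (G\<^sub>E O rrestrict (weyl_family \<Gamma> z) (Range G\<^sub>E) O radj G)" for h y
    unfolding weyl_transformed mem_rsum rrestrict_def by blast
  then show ?thesis
    by auto
qed

lemma Domain_weyl_transformed:
  "Domain (weyl_family \<Gamma>' z) = {h \<in> Domain E\<^sub>G. \<exists>k\<in>Domain (radj G).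
    (h, k) \<in> G\<^sub>E O rrestrict (weyl_family \<Gamma> z) (Range G\<^sub>E)}"
  unfolding set_eq_iff Domain_iff mem_Collect_eq weyl_transformed mem_restricted_weyl rrestrict_def
  by blast

text \<open>A value over 0 comes from an eigenvector with \<open>l = 0\<close>, that is, from one in
  the self-adjoint \<open>ker \<Gamma>\<^sub>0\<close>; at non-real \<open>z\<close> it is
  zero.\<close>

lemma is_operator_weyl_transformed:
  assumes "z \<notin> \<real>"
  shows "is_operator (weyl_family \<Gamma>' z)"
proof -
  have linear': "linear_relation \<Gamma>'"
    by (intro linear_relation_relcomp linear operator_linear is_operator_Vop)
  have "y = 0" if "(0, y) \<in> weyl_family \<Gamma>' z" for y
  proof -
    from that obtain l l' k m where *: "(l, l') \<in> weyl_family \<Gamma> z" "(0, l) \<in> G" "(0, k) \<in> E"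
      "(l', m) \<in> radj G" "y = k + m"
      unfolding weyl_transformed by blast
    have [simp]: "l = 0" "k = 0"
      using *(2,3) operator_zero[OF G(1)] operator_zero[OF E(1)] by simp_all
    from *(1) obtain f where f: "((f, z *\<^sub>c f), (0, l')) \<in> \<Gamma>"
      by (auto simp: weyl_family_def)
    then have "(f, z *\<^sub>c f) \<in> rker (bfst \<Gamma>)"
      by (auto simp: rker_def bfst_def)
    then have "f = 0"
      using selfadjoint_rker_bfst assms
      by (intro symmetric_eigenvector_zero) (auto simp: selfadjoint_rel_def symmetric_rel_def)
    with f have "l' = 0"
      using operator_zero[OF operator] by (auto simp: zero_prod_def)
    then have "m = 0"
      using *(4) operator_zero[OF operator_radj] by simp
    then show "y = 0"
      using *(5) by simp
  qed
  then show ?thesis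
    using linear_relation_weyl_family[OF linear'] by (intro is_operatorI)
qed

lemma Range_bfst_transformed:
  assumes "z \<notin> \<real>"
  shows "Range (bfst \<Gamma>') = {h \<in> Domain E\<^sub>G. \<exists>f\<^sub>0 \<in> rker (bfst \<Gamma>). \<exists>k\<^sub>0 k. (f\<^sub>0, k\<^sub>0) \<in> bsnd \<Gamma> \<and>
    (h, k) \<in> G\<^sub>E O rrestrict (weyl_family \<Gamma> z) (Range G\<^sub>E) \<and> k\<^sub>0 + k \<in> Domain (radj G)}"
    (is "_ = ?R")
proof -
  have ker: "f \<in> rker (bfst \<Gamma>) \<and> (f, k) \<in> bsnd \<Gamma> \<longleftrightarrow> (f, (0, k)) \<in> \<Gamma>" for f k
    by (auto simp: rker_def bfst_def bsnd_def dest: unique)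
  have "h \<in> Range (bfst \<Gamma>') \<longleftrightarrow> h \<in> ?R" for h
  proof
    assume "h \<in> Range (bfst \<Gamma>')"
    then obtain f l l' k m where *: "(f, (l, l')) \<in> \<Gamma>" "(h, l) \<in> G" "(h, k) \<in> E" "(l', m) \<in> radj G"
      unfolding bfst_def Range_iff mem_Collect_eq prod.case mem_iff' by blast
    obtain q where q: "(l, q) \<in> weyl_family \<Gamma> z"
      using weyl_total[OF assms] by blast
    then obtain u where "((u, z *\<^sub>c u), (l, q)) \<in> \<Gamma>"
      by (auto simp: weyl_family_def)
    \<comment> \<open>Subtracting the eigenvector element with the same first boundary value
      \<open>l\<close> lands in \<open>ker \<Gamma>\<^sub>0\<close>; the converse direction adds it
      back.\<close>
    then have "(f - (u, z *\<^sub>c u), (0, l' - q)) \<in> \<Gamma>"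
      using linear_relation_diff[OF linear *(1)] by fastforce
    then have "f - (u, z *\<^sub>c u) \<in> rker (bfst \<Gamma>)" "(f - (u, z *\<^sub>c u), l' - q) \<in> bsnd \<Gamma>"
      using ker by blast+
    moreover have "(l' - q) + q \<in> Domain (radj G)"
      using *(4) by auto
    moreover have "(h, q) \<in> G\<^sub>E O rrestrict (weyl_family \<Gamma> z) (Range G\<^sub>E)"
      unfolding mem_restricted_weyl using *(2,3) q by blast
    moreover have "h \<in> Domain E\<^sub>G"
      using *(2,3) by (auto simp: Domain_rrestrict)
    ultimately show "h \<in> ?R"
      unfolding mem_Collect_eq by (intro conjI bexI exI)
  next
    assume "h \<in> ?R"
    then obtain f k\<^sub>0 k where 1: "f \<in> rker (bfst \<Gamma>)" "(f, k\<^sub>0) \<in> bsnd \<Gamma>"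
      "(h, k) \<in> G\<^sub>E O rrestrict (weyl_family \<Gamma> z) (Range G\<^sub>E)" "k\<^sub>0 + k \<in> Domain (radj G)"
      by (elim CollectE conjE bexE exE)
    from 1(3) obtain l e where "(h, e) \<in> E" "(h, l) \<in> G" "(l, k) \<in> weyl_family \<Gamma> z"
      unfolding mem_restricted_weyl by (elim conjE DomainE exE)
    moreover from 1(4) obtain m where "(k\<^sub>0 + k, m) \<in> radj G"
      by (rule DomainE)
    ultimately obtain u m where *: "(f, (0, k\<^sub>0)) \<in> \<Gamma>" "((u, z *\<^sub>c u), (l, k)) \<in> \<Gamma>"
      "(h, e) \<in> E" "(h, l) \<in> G" "(k\<^sub>0 + k, m) \<in> radj G"
      using 1(1,2) ker[of f k\<^sub>0] unfolding weyl_family_def by (elim CollectE exE) simp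
    have "(f + (u, z *\<^sub>c u), (l, k\<^sub>0 + k)) \<in> \<Gamma>"
      using linear_relation_add[OF linear *(1,2)] by simp
    then have "(f + (u, z *\<^sub>c u), (h, e + m)) \<in> \<Gamma>'"
      unfolding mem_iff' using *(3-5) by blast
    then show "h \<in> Range (bfst \<Gamma>')"
      by (auto simp: bfst_def)
  qed
  then show ?thesis
    by blast
qed

lemma Domain_weyl_subset: "Domain (weyl_family \<Gamma>' z) \<subseteq> Range (bfst \<Gamma>')"
  unfolding weyl_family_def bfst_def by blast

text \<open>Every \<open>h\<close> in the range has a \<open>k\<close> paired with it, and
  membership of \<open>k\<close> in \<open>Domain (radj G)\<close> is now automatic.\<close>

lemma Domain_weyl_eq:
  assumes "z \<notin> \<real>" "Domain (radj G) = UNIV"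
  shows "Domain (weyl_family \<Gamma>' z) = Range (bfst \<Gamma>')"
proof -
  have "(h, q) \<in> G\<^sub>E O rrestrict (weyl_family \<Gamma> z) (Range G\<^sub>E) \<Longrightarrow> h \<in> Domain E\<^sub>G" for h q
    unfolding rrestrict_def by blast
  then show ?thesis
    using Domain_weyl_subset unfolding Range_bfst_transformed[OF assms(1)] Domain_weyl_transformed assms(2)
    by blast
qed

lemma isometric_bt_transformed:
  assumes "rmul (closure G) \<subseteq> closure (Range G\<^sub>E)"
  shows "isometric_bt (\<Gamma>\<inverse> `` (rmul (closure G) \<times> rker (radj G\<^sub>E))) \<Gamma>'"
  using isometric_bt_relcomp[OF is_operator_Vop Vop_isometric radj_Domain_Vop_le[OF assms]]
  by (simp add: radj_Domain_Vop)

lemma radj_transformed: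
  "radj (\<Gamma>\<inverse> `` (rmul (closure G) \<times> rker (radj G\<^sub>E))) =
    \<Gamma>\<inverse> `` (closure (Range G\<^sub>E) \<times> closure (Domain (radj G)))"
  unfolding radj_Domain_Vop[symmetric] radj_radj_Domain_Vop[symmetric]
  by (rule radj_preimage) (simp add: mem_radj_iff_green)

text \<open>Density makes the adjoint of \<open>Domain (Vop E G)\<close> trivial, so its preimage is
  \<open>T\<close> itself. The range of \<Gamma>' is that of the block operator since \<Gamma> is
  onto.\<close>

lemma quasi_bt_transformed:
  assumes "closure (Range G) = UNIV" "Domain (radj G) = UNIV"
    and "rrestrict (radj E\<^sub>G) (rker (closure G)) = {(0, 0)}"
  shows "quasi_bt T \<Gamma>'"
proof -
  note dense = dense_if_Domain_radj_UNIV[OF assms]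
  have "radj (Domain (Vop E G)) = {0}"
    using dense(1) orth_orth[OF csubspace_Range[OF linear_restrict(1)]]
      closure_eq_UNIV_iff_orth[OF csubspace_Range[OF linear_restrict(1)]]
    by (simp add: radj_Domain_Vop rmul_closure linear_G assms(2) rker_radj orth_UNIV zero_prod_def)
  then have T: "T = \<Gamma>\<inverse> `` radj (Domain (Vop E G))"
    by (simp only: T_eq rker_def) blast
  have "isometric_bt T \<Gamma>'"
    unfolding T using dense(1) by (intro isometric_bt_relcomp is_operator_Vop Vop_isometric radj_Domain_Vop_le) simp
  moreover have "Range \<Gamma>' = Range (Vop E G)"
    using surjective by blast
  \<comment> \<open>Both kernels require first boundary value 0, and the second one is unrestricted
    because \<open>radj G\<close> is everywhere defined.\<close>
  moreover have "rker (bfst \<Gamma>') = rker (bfst \<Gamma>)"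
  proof -
    have "(f, (0, y)) \<in> \<Gamma>' \<Longrightarrow> \<exists>l'. (f, (0, l')) \<in> \<Gamma>" for f y
      unfolding mem_iff' using operator_zero[OF G(1)] by blast
    moreover have "\<exists>y. (f, (0, y)) \<in> \<Gamma>'" if "(f, (0, l')) \<in> \<Gamma>" for f l'
      unfolding mem_iff'
      using that linear_relation_zero[OF linear_G] linear_relation_zero[OF linear_E] assms(2) by blast
    ultimately show ?thesis
      unfolding rker_def bfst_def by blast
  qed
  ultimately show ?thesis
    using dense(2) selfadjoint_rker_bfst by (simp add: quasi_bt_def)
qed

end

theorem proposition7p11:
  fixes T T' A' :: "('a::chilbert \<times> 'a) set"
    and \<Gamma> \<Gamma>' :: "(('a \<times> 'a) \<times> ('b::chilbert \<times> 'b)) set"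
    and \<Gamma>\<^sub>0 \<Gamma>\<^sub>1 \<Gamma>\<^sub>0' \<Gamma>\<^sub>1' :: "(('a \<times> 'a) \<times> 'b) set"
    and E G G\<^sub>E E\<^sub>G :: "('b \<times> 'b) set"
    and M M\<^sub>0 M' :: "complex \<Rightarrow> ('b \<times> 'b) set"
  defines "\<Gamma>\<^sub>0 \<equiv> bfst \<Gamma>" and "\<Gamma>\<^sub>1 \<equiv> bsnd \<Gamma>"
    and "G\<^sub>E \<equiv> rrestrict G (Domain E)" and "E\<^sub>G \<equiv> rrestrict E (Domain G)"
    and "\<Gamma>' \<equiv> \<Gamma> O Vop E G"
    and "A' \<equiv> {f \<in> radj T. \<exists>l \<in> Range G\<^sub>E. \<exists>l' \<in> Domain (radj G). (f, l) \<in> \<Gamma>\<^sub>0 \<and> (f, l') \<in> \<Gamma>\<^sub>1}"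
    and "\<Gamma>\<^sub>0' \<equiv> rrestrict (\<Gamma>\<^sub>0 O G\<^sub>E\<inverse>) A'"
    and "\<Gamma>\<^sub>1' \<equiv> rrestrict (rsum (\<Gamma>\<^sub>0 O G\<^sub>E\<inverse> O E\<^sub>G) (\<Gamma>\<^sub>1 O radj G)) A'"
    and "T' \<equiv> {f \<in> radj T. \<exists>l \<in> rmul (closure G). \<exists>l' \<in> rker (radj G\<^sub>E). (f, l) \<in> \<Gamma>\<^sub>0 \<and> (f, l') \<in> \<Gamma>\<^sub>1}"
    and "M \<equiv> weyl_family \<Gamma>" and "M' \<equiv> weyl_family \<Gamma>'"
    and "M\<^sub>0 \<equiv> \<lambda>z. rrestrict (M z) (Range G\<^sub>E)"
  assumes "closed_symmetric T" and "ordinary_bt T \<Gamma>"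
    and "is_operator E" and "densely_defined E" and "symmetric_rel E"
    and "is_operator G" and "densely_defined G" and "rker G = {0}" and "closure (Range G) = UNIV"
    and "rmul (closure G) \<subseteq> closure (Range G\<^sub>E)"
  shows "\<Gamma>' = bpair \<Gamma>\<^sub>0' \<Gamma>\<^sub>1' \<and> Domain \<Gamma>' = A' \<and>
    closed_symmetric T' \<and> T \<subseteq> T' \<and>
    radj T' = {f \<in> radj T. \<exists>l \<in> closure (Range G\<^sub>E). \<exists>l' \<in> closure (Domain (radj G)).
                 (f, l) \<in> \<Gamma>\<^sub>0 \<and> (f, l') \<in> \<Gamma>\<^sub>1} \<and>
    isometric_bt T' \<Gamma>' \<and>
    (\<forall>z. z \<notin> \<real> \<longrightarrow>
       is_operator (M' z) \<and>
       M' z = rsum E\<^sub>G (G\<^sub>E O M\<^sub>0 z O radj G) \<and>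
       Domain (M' z) = {h \<in> Domain E\<^sub>G. \<exists>k \<in> Domain (radj G). (h, k) \<in> G\<^sub>E O M\<^sub>0 z} \<and>
       Domain (M' z) \<subseteq> Range \<Gamma>\<^sub>0' \<and>
       Range \<Gamma>\<^sub>0' = {h \<in> Domain E\<^sub>G. \<exists>f\<^sub>0 \<in> rker \<Gamma>\<^sub>0. \<exists>k\<^sub>0 k. (f\<^sub>0, k\<^sub>0) \<in> \<Gamma>\<^sub>1 \<and>
                       (h, k) \<in> G\<^sub>E O M\<^sub>0 z \<and> k\<^sub>0 + k \<in> Domain (radj G)}) \<and>
    (rrestrict (radj E\<^sub>G) (rker (closure G)) = {(0, 0)} \<and> \<Gamma>\<^sub>1 `` rker \<Gamma>\<^sub>0 \<subseteq> Domain (radj G) \<longrightarrow>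
       closure (Domain (radj G)) = UNIV \<and> closure (Range G\<^sub>E) = UNIV \<and>
       quasi_bt T \<Gamma>' \<and>
       (\<forall>z. z \<notin> \<real> \<longrightarrow> Domain (M' z) = Range \<Gamma>\<^sub>0'))"
proof -
  interpret transformed_triple T \<Gamma> E G
    using assms(14,15,17-20) by unfold_locales
  note \<Gamma>\<^sub>0 = assms(1) and \<Gamma>\<^sub>1 = assms(2) and G\<^sub>E = assms(3) and E\<^sub>G = assms(4) and \<Gamma>' = assms(5)
    and M = assms(10,11,12) and dense = assms(21) and mul = assms(22)[unfolded G\<^sub>E]
  have A': "A' = \<Gamma>\<inverse> `` (Range G\<^sub>E \<times> Domain (radj G))"
    unfolding assms(6) \<Gamma>\<^sub>0 \<Gamma>\<^sub>1 by (rule preimage_times)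
  have T': "T' = \<Gamma>\<inverse> `` (rmul (closure G) \<times> rker (radj G\<^sub>E))"
    unfolding assms(9) \<Gamma>\<^sub>0 \<Gamma>\<^sub>1 by (rule preimage_times)
  have bpair: "\<Gamma>' = bpair \<Gamma>\<^sub>0' \<Gamma>\<^sub>1'"
    unfolding assms(7,8) \<Gamma>\<^sub>0 \<Gamma>\<^sub>1 \<Gamma>' A' G\<^sub>E E\<^sub>G by (rule bpair_transformed)
  have Domain: "Domain \<Gamma>' = A'"
    unfolding \<Gamma>' A' G\<^sub>E by (rule Domain_transformed)
  have \<Gamma>\<^sub>0': "\<Gamma>\<^sub>0' = bfst \<Gamma>'"
    unfolding assms(7) \<Gamma>\<^sub>0 \<Gamma>' A' G\<^sub>E by (rule bfst_transformed[symmetric])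
  have isometric: "isometric_bt T' \<Gamma>'"
    unfolding T' \<Gamma>' G\<^sub>E using mul by (rule isometric_bt_transformed)
  then have closed_symmetric: "closed_symmetric T'"
    unfolding isometric_bt_def by (rule conjunct1)
  have extension: "T \<subseteq> T'"
  proof -
    have "0 \<in> rmul (closure G) \<times> rker (radj G\<^sub>E)"
      by (simp add: rmul_closure linear_G rker_radj zero_prod_def)
    moreover have "(f, 0) \<in> \<Gamma>" if "f \<in> T" for f
      using that unfolding T_eq rker_def by simp
    ultimately show ?thesis
      unfolding T' by (intro subsetI ImageI) auto
  qed
  have radj_T': "radj T' = {f \<in> radj T. \<exists>l \<in> closure (Range G\<^sub>E). \<exists>l' \<in> closure (Domain (radj G)).
                 (f, l) \<in> \<Gamma>\<^sub>0 \<and> (f, l') \<in> \<Gamma>\<^sub>1}"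
    unfolding \<Gamma>\<^sub>0 \<Gamma>\<^sub>1 preimage_times unfolding T' G\<^sub>E by (rule radj_transformed)
  have weyl: "is_operator (M' z) \<and>
       M' z = rsum E\<^sub>G (G\<^sub>E O M\<^sub>0 z O radj G) \<and>
       Domain (M' z) = {h \<in> Domain E\<^sub>G. \<exists>k \<in> Domain (radj G). (h, k) \<in> G\<^sub>E O M\<^sub>0 z} \<and>
       Domain (M' z) \<subseteq> Range \<Gamma>\<^sub>0' \<and>
       Range \<Gamma>\<^sub>0' = {h \<in> Domain E\<^sub>G. \<exists>f\<^sub>0 \<in> rker \<Gamma>\<^sub>0. \<exists>k\<^sub>0 k. (f\<^sub>0, k\<^sub>0) \<in> \<Gamma>\<^sub>1 \<and>
                       (h, k) \<in> G\<^sub>E O M\<^sub>0 z \<and> k\<^sub>0 + k \<in> Domain (radj G)}" if "z \<notin> \<real>" for z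
    unfolding M \<Gamma>\<^sub>0' \<Gamma>\<^sub>0 \<Gamma>\<^sub>1 \<Gamma>' G\<^sub>E E\<^sub>G
    by (intro conjI is_operator_weyl_transformed[OF that] weyl_transformed_eq
        Domain_weyl_transformed Domain_weyl_subset Range_bfst_transformed[OF that])
  have quasi: "closure (Domain (radj G)) = UNIV \<and> closure (Range G\<^sub>E) = UNIV \<and>
       quasi_bt T \<Gamma>' \<and> (\<forall>z. z \<notin> \<real> \<longrightarrow> Domain (M' z) = Range \<Gamma>\<^sub>0')"
    if ker: "rrestrict (radj E\<^sub>G) (rker (closure G)) = {(0, 0)}"
      and T\<^sub>0: "\<Gamma>\<^sub>1 `` rker \<Gamma>\<^sub>0 \<subseteq> Domain (radj G)"
  proof -
    have "l \<in> Domain (radj G)" for l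
    proof -
      \<comment> \<open>Surjectivity makes every \<open>l\<close> the
        \<open>\<Gamma>\<^sub>1\<close>-value of an element of \<open>ker \<Gamma>\<^sub>0\<close>,
        so the inclusion \<open>T\<^sub>0\<close> forces \<open>radj G\<close> to be everywhere
        defined.\<close>
      obtain f where "(f, (0, l)) \<in> \<Gamma>"
        using surjective by (metis Range_iff UNIV_I)
      then have "f \<in> rker \<Gamma>\<^sub>0" "(f, l) \<in> \<Gamma>\<^sub>1"
        unfolding \<Gamma>\<^sub>0 \<Gamma>\<^sub>1 rker_def bfst_def bsnd_def by blast+
      then show ?thesis
        using T\<^sub>0 by blast
    qed
    then have UNIV: "Domain (radj G) = UNIV"
      by blast
    note prems = dense UNIV ker[unfolded E\<^sub>G]
    show ?thesis
      using UNIV dense_if_Domain_radj_UNIV(1)[OF prems] quasi_bt_transformed[OF prems]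
        Domain_weyl_eq[OF _ UNIV]
      unfolding M \<Gamma>\<^sub>0' \<Gamma>' G\<^sub>E by simp
  qed
  show ?thesis
    by (rule conjI[OF bpair conjI[OF Domain conjI[OF closed_symmetric conjI[OF extension
          conjI[OF radj_T' conjI[OF isometric conjI]]]]]],
        intro allI impI, rule weyl, assumption, rule impI, elim conjE, rule quasi; assumption)
qed

end
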